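(* Let $\mu,\alpha,\beta$ be cylindric partitions with $\mu\subseteq\alpha$, $\mu\subseteq\beta$, and let $T\in\operatorname{SSCT}(\alpha/\mu)$, $U\in\operatorname{SSCT}(\beta/\mu)$. If $\operatorname{CRSK}(((T,U),\mu))=((P,Q),\lambda)$, then $\operatorname{CRSK}(((U,T),\mu))=((Q,P),\lambda)$.
   Context: Fix integers $n>k\ge1$. A cylindric partition is a weakly decreasing integer sequence $(\lambda_m)_{m\in\mathbb Z}$ with $\lambda_m=\lambda_{m+k}+n-k$. A point $(x,y)\in\mathbb Z^2$ is in plane row $x$ and lies in $\lambda$ if $y\le\lambda_x$. Boxes are classes of points modulo translation by multiples of $(-k,n-k)$; $\pi$ is the projection; row $x$ of the cylinder is the image of plane row $x$ (rows are indexed mod $k$), column $y$ is the image of plane column $y$. Within a row, boxes are ordered left to right by the $y$-coordinate of their representatives in a fixed plane row. $\mu\subseteq\lambda$ means $\mu_m\le\lambda_m$ for all $m$; boxes of $\lambda/\mu$ are those in $\lambda$ not in $\mu$. A (semistandard cylindric) tableau of shape $\lambda/\mu$ with entries in a totally ordered alphabet $A$ is a map $R$ from the boxes of $\lambda/\mu$ to $A$ such that entries weakly increase along plane rows (if $(x,y_1),(x,y_2)$ lie in $\lambda$ but not $\mu$ and $y_1<y_2$ then $R(\pi(x,y_1))\le R(\pi(x,y_2))$) and strictly increase down plane columns (if $(x_1,y),(x_2,y)$ lie in $\lambda$ but not $\mu$ and $x_1<x_2$ then $R(\pi(x_1,y))<R(\pi(x_2,y))$); its outer and inner shapes $\lambda,\mu$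 are part of its data. $\operatorname{SSCT}(\lambda/\mu)$ is the set of these. Full multi-insertion $\operatorname{FullMulti}(R,S)$: the input is a tableau $R$ with outer shape $\lambda$ and inner shape $\mu$, and a set $S$ of boxes not in $\mu$, no two in the same column, such that adding the boxes of $S$ to $\mu$ gives a cylindric partition. Choose an integer $r$ (the result does not depend on it). For $h=r,r+1,\dots,r+k-1$, go through the boxes of $S$ in row $h$ from left to right: if the box is in $\lambda$, remove its entry $x$ from $R$ and append the pair $(x,h+1)$ to a queue $q_0$; otherwise add the box to $\lambda$ (it stays empty). All boxes of $S$ are added to the inner shape. Then repeat the following one-step procedure while the current queue $q$ is nonempty: start a new empty queue $q'$; remove pairs $(x,s)$ from the front of $q$ one at a time; if $x$ is $\ge$ every entry currently in row $s$, put $x$ into the leftmost box of row $s$ not in the current outer shape and add that box to the outer shape; otherwise let $B$ be the box of the leftmost entry in row $s$ that is greater than $x$, let $x'$ be that entry, replace it by $x$, and append $(x',s+1)$ to $q'$; when $q$ is empty set $q:=q'$. The output is the resulting tableau; the new set $N(R,S)$ is the set of boxes in its outer shape but not in $\lambda$. $\operatorname{CRSK}(((T,U),\mu))$ for $T\in\operatorname{SSCT}(\alpha/\mu)$, $U\in\operatorname{SSCT}(\beta/\mu)$ is computed as follows: set $P:=T$ and let $Q$ be the empty tableau of shape $\alpha/\alpha$. For each letter $i$ occurring in $U$, in increasing order: let $S$ be the set of boxes containing $i$ in $U$; set $S':=N(P,S)$ and $P:=\operatorname{FullMulti}(P,S)$; put $i$ into every box of $S'$ in $Q$ and add the boxes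 of $S'$ to the outer shape of $Q$. Finally let $\lambda$ be the outer shape of $P$ and return $((P,Q),\lambda)$. (Then $P\in\operatorname{SSCT}(\lambda/\beta)$ and $Q\in\operatorname{SSCT}(\lambda/\alpha)$.) *)

theory Defs
  imports Main "HOL-Library.While_Combinator"
begin

(* Fixed integers n > k >= 1 are passed explicitly as parameters n k :: int. *)

definition cyl_partition :: "int \<Rightarrow> int \<Rightarrow> (int \<Rightarrow> int) \<Rightarrow> bool" where
  "cyl_partition n k lam \<longleftrightarrow>
     (\<forall>m m'. m \<le> m' \<longrightarrow> lam m' \<le> lam m) \<and> (\<forall>m. lam m = lam (m + k) + (n - k))"

definition contained :: "(int \<Rightarrow> int) \<Rightarrow> (int \<Rightarrow> int) \<Rightarrow> bool" where
  "contained mu lam \<longleftrightarrow> (\<forall>m. mu m \<le> lam m)"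

text \<open>Boxes are classes of points of int x int modulo translation by multiples of
  (-k, n-k).  A box is represented by its unique representative (r,y) with 0 <= r < k;
  the projection pi maps a point to this canonical representative.  The row of the
  box (r,y) is r (rows mod k), and within a row boxes are ordered by y.\<close>
definition proj :: "int \<Rightarrow> int \<Rightarrow> int \<times> int \<Rightarrow> int \<times> int" where
  "proj n k p = (fst p mod k, snd p + (fst p div k) * (n - k))"

definition is_box :: "int \<Rightarrow> int \<times> int \<Rightarrow> bool" where
  "is_box k b \<longleftrightarrow> 0 \<le> fst b \<and> fst b < k"

definition in_skew :: "(int \<Rightarrow> int) \<Rightarrow> (int \<Rightarrow> int) \<Rightarrow> int \<times> int \<Rightarrow> bool" where
  "in_skew lam mu p \<longleftrightarrow> mu (fst p) < snd p \<and> snd p \<le> lam (fst p)"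

definition skew_boxes :: "int \<Rightarrow> (int \<Rightarrow> int) \<Rightarrow> (int \<Rightarrow> int) \<Rightarrow> (int \<times> int) set" where
  "skew_boxes k lam mu = {b. is_box k b \<and> in_skew lam mu b}"

text \<open>A tableau: outer shape, inner shape and entries (defined exactly on the boxes
  of outer/inner, given by canonical representatives).\<close>
record 'a tab =
  outer :: "int \<Rightarrow> int"
  inner :: "int \<Rightarrow> int"
  ent :: "int \<times> int \<Rightarrow> 'a option"

definition SSCT :: "int \<Rightarrow> int \<Rightarrow> (int \<Rightarrow> int) \<Rightarrow> (int \<Rightarrow> int) \<Rightarrow> ('a::linorder) tab set" where
  "SSCT n k lam mu = {R.
     outer R = lam \<and> inner R = mu \<and>
     cyl_partition n k lam \<and> cyl_partition n k mu \<and> contained mu lam \<and>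
     (\<forall>b. ent R b \<noteq> None \<longleftrightarrow> b \<in> skew_boxes k lam mu) \<and>
     (\<forall>x y1 y2. in_skew lam mu (x, y1) \<and> in_skew lam mu (x, y2) \<and> y1 < y2 \<longrightarrow>
        the (ent R (proj n k (x, y1))) \<le> the (ent R (proj n k (x, y2)))) \<and>
     (\<forall>x1 x2 y. in_skew lam mu (x1, y) \<and> in_skew lam mu (x2, y) \<and> x1 < x2 \<longrightarrow>
        the (ent R (proj n k (x1, y))) < the (ent R (proj n k (x2, y)))) }"

text \<open>Adding a finite set B of boxes to a shape lam (union of the point sets, for B
  adjacent to lam as in all uses below).  The representative of box (r,y) in plane
  row m (with m mod k = r) is (m, y - (m div k)*(n-k)).\<close>
definition add_boxes :: "int \<Rightarrow> int \<Rightarrow> (int \<Rightarrow> int) \<Rightarrow> (int \<times> int) set \<Rightarrow> int \<Rightarrow> int" where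
  "add_boxes n k lam B m =
     Max (insert (lam m) {y - (m div k) * (n - k) | y. (m mod k, y) \<in> B})"

text \<open>Initial phase of full multi-insertion, with r = 0: for h = 0..k-1, go through the
  boxes of S in row h left to right.\<close>
definition fm_queue0 :: "int \<Rightarrow> 'a tab \<Rightarrow> (int \<times> int) set \<Rightarrow> ('a \<times> int) list" where
  "fm_queue0 k R S =
     concat (map (\<lambda>h. map (\<lambda>y. (the (ent R (h, y)), (h + 1) mod k))
                      (sorted_list_of_set {y. (h, y) \<in> S \<and> y \<le> outer R h}))
             [0..k - 1])"

definition fm_init :: "int \<Rightarrow> int \<Rightarrow> 'a tab \<Rightarrow> (int \<times> int) set \<Rightarrow> 'a tab" where
  "fm_init n k R S =
     R\<lparr> outer := add_boxes n k (outer R) {b \<in> S. outer R (fst b) < snd b},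
        inner := add_boxes n k (inner R) S,
        ent := (\<lambda>b. if b \<in> S then None else ent R b) \<rparr>"

text \<open>One step of the bumping procedure, processing the front pair (x,s) of the queue.
  Appending bumped pairs to the end of a single FIFO queue performs exactly the same
  sequence of operations as the round-by-round description with q and q'.\<close>
fun fm_step :: "int \<Rightarrow> int \<Rightarrow> ('a::linorder) tab \<times> ('a \<times> int) list \<Rightarrow> 'a tab \<times> ('a \<times> int) list" where
  "fm_step n k (R, []) = (R, [])"
| "fm_step n k (R, (x, s) # q) =
     (if \<forall>y v. ent R (s, y) = Some v \<longrightarrow> v \<le> x then
        (let y = outer R s + 1 in
          (R\<lparr> outer := add_boxes n k (outer R) {(s, y)}, ent := (ent R)((s, y) := Some x) \<rparr>, q))
      else
        (let y = Min {y. \<exists>v. ent R (s, y) = Some v \<and> x < v};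
             x' = the (ent R (s, y)) in
          (R\<lparr> ent := (ent R)((s, y) := Some x) \<rparr>, q @ [(x', (s + 1) mod k)])))"

definition FullMulti :: "int \<Rightarrow> int \<Rightarrow> ('a::linorder) tab \<Rightarrow> (int \<times> int) set \<Rightarrow> 'a tab option" where
  "FullMulti n k R S =
     map_option fst
       (while_option (\<lambda>(R', q). q \<noteq> []) (fm_step n k) (fm_init n k R S, fm_queue0 k R S))"

definition new_boxes :: "int \<Rightarrow> 'a tab \<Rightarrow> 'a tab \<Rightarrow> (int \<times> int) set" where
  "new_boxes k R R' = {b. is_box k b \<and> outer R (fst b) < snd b \<and> snd b \<le> outer R' (fst b)}"

definition crsk_letter :: "int \<Rightarrow> int \<Rightarrow> ('a::linorder) tab \<Rightarrow> 'a \<Rightarrow> ('a tab \<times> 'a tab) option \<Rightarrow> ('a tab \<times> 'a tab) option" where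
  "crsk_letter n k U i acc =
     Option.bind acc (\<lambda>(P, Q).
       let S = {b. ent U b = Some i} in
       map_option (\<lambda>P'. let S' = new_boxes k P P' in
           (P', Q\<lparr> outer := add_boxes n k (outer Q) S',
                   ent := (\<lambda>b. if b \<in> S' then Some i else ent Q b) \<rparr>))
         (FullMulti n k P S))"

definition CRSK :: "int \<Rightarrow> int \<Rightarrow> (('a::linorder) tab \<times> 'a tab) \<times> (int \<Rightarrow> int)
                    \<Rightarrow> (('a tab \<times> 'a tab) \<times> (int \<Rightarrow> int)) option" where
  "CRSK n k TUmu =
     (let T = fst (fst TUmu); U = snd (fst TUmu);
          Q0 = \<lparr> outer = outer T, inner = outer T, ent = (\<lambda>_. None) \<rparr> in
      map_option (\<lambda>(P, Q). ((P, Q), outer P))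
        (fold (crsk_letter n k U) (sorted_list_of_set (ran (ent U))) (Some (T, Q0))))"

end

theory Submission
  imports Defs
begin

text \<open>A tableau with letters \<open>a\<^sub>0 < a\<^sub>1 < \<dots>\<close> is a chain of shapes \<open>G 0 \<le> G 1 \<le> \<dots>\<close>, where the
  letter \<open>a\<^sub>j\<close> fills the boxes between \<open>G j\<close> and \<open>G (j + 1)\<close>.  During a full multi-insertion the
  entries inserted into any fixed row form, over all rounds, a weakly increasing sequence, so the
  bumped positions of a row move strictly to the right and every original entry is bumped at most
  once.  Hence an original letter \<open>a\<^sub>j\<close> leaves row \<open>m - 1\<close> exactly if its position is \<open>\<le> G' j (m - 1)\<close>,
  where \<open>G'\<close> is the chain of the result, and it then settles in row \<open>m\<close>.  Counting letters gives the
  local rule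
    \<open>G' (j+1) m = max (G (j+1) m) (G' j m) + min (G (j+1) (m-1)) (G' j (m-1)) - G j (m-1)\<close>,
  which is symmetric in the two intermediate shapes \<open>G (j+1)\<close> and \<open>G' j\<close>.  So CRSK is computed by a
  growth diagram that is transposed when the two input tableaux are exchanged.\<close>

section \<open>Shapes and level chains of row tableaux\<close>

text \<open>The translation half of \<open>cyl_partition\<close>. It reduces statements about all
  plane rows to the canonical rows from 0 to \<open>k - 1\<close>.\<close>

definition periodic :: "int \<Rightarrow> int \<Rightarrow> (int \<Rightarrow> int) \<Rightarrow> bool" where
  "periodic n k f \<longleftrightarrow> (\<forall>m. f m = f (m + k) + (n - k))"

lemma periodic_add_mult:
  assumes "periodic n k f"
  shows "f (m + j * k) = f m - j * (n - k)"
proof (induction j rule: int_induct[where k = 0])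
  case base
  show ?case by simp
next
  case (step1 j)
  have "f (m + j * k) = f (m + j * k + k) + (n - k)"
    using assms unfolding periodic_def by blast
  moreover have "f (m + (j + 1) * k) = f (m + j * k + k)" by (rule arg_cong[of _ _ f]) (simp add: algebra_simps)
  moreover have "(j + 1) * (n - k) = j * (n - k) + (n - k)" by (simp add: algebra_simps)
  ultimately show ?case using step1(2) by linarith
next
  case (step2 j)
  have "f (m + (j - 1) * k) = f (m + (j - 1) * k + k) + (n - k)"
    using assms unfolding periodic_def by blast
  moreover have "f (m + (j - 1) * k + k) = f (m + j * k)" by (rule arg_cong[of _ _ f]) (simp add: algebra_simps)
  moreover have "(j - 1) * (n - k) = j * (n - k) - (n - k)" by (simp add: algebra_simps)
  ultimately show ?case using step2(2) by linarith
qed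

lemma periodic_mod:
  assumes "periodic n k f"
  shows "f m = f (m mod k) - (m div k) * (n - k)"
  using periodic_add_mult[OF assms, of "m mod k" "m div k"] by simp

lemma periodic_ext:
  assumes "1 \<le> k" "periodic n k f" "periodic n k g"
    and "\<And>r. 0 \<le> r \<Longrightarrow> r < k \<Longrightarrow> f r = g r"
  shows "f = g"
proof
  fix m
  have "f (m mod k) = g (m mod k)" using assms(1,4) by simp
  then show "f m = g m"
    using periodic_mod[OF assms(2), of m] periodic_mod[OF assms(3), of m] by simp
qed

text \<open>Translated to plane row \<open>m\<close>, the boxes of \<open>B\<close> become the
  interval from \<open>lam m\<close> (excluded) to \<open>c m\<close>, so the \<open>Max\<close> is
  \<open>c m\<close>. Every update of a shape is evaluated by this lemma.\<close>

lemma add_boxes_eq: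
  assumes k: "1 \<le> k" and lam: "periodic n k lam" and c: "periodic n k c"
    and le: "\<And>m. lam m \<le> c m"
    and B: "\<And>r y. 0 \<le> r \<Longrightarrow> r < k \<Longrightarrow> (r, y) \<in> B \<longleftrightarrow> lam r < y \<and> y \<le> c r"
  shows "add_boxes n k lam B = c"
proof
  fix m
  let ?d = "(m div k) * (n - k)"
  have r: "0 \<le> m mod k" "m mod k < k" using k by simp_all
  have "{y - ?d | y. (m mod k, y) \<in> B} = {y - ?d | y. lam (m mod k) < y \<and> y \<le> c (m mod k)}"
    using B[OF r] by auto
  also have "\<dots> = {z. lam m < z \<and> z \<le> c m}"
  proof (intro set_eqI iffI)
    fix z assume "z \<in> {z. lam m < z \<and> z \<le> c m}"
    then have "z = (z + ?d) - ?d \<and> lam (m mod k) < z + ?d \<and> z + ?d \<le> c (m mod k)"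
      using periodic_mod[OF lam, of m] periodic_mod[OF c, of m] by simp
    then show "z \<in> {y - ?d | y. lam (m mod k) < y \<and> y \<le> c (m mod k)}" by blast
  qed (use periodic_mod[OF lam, of m] periodic_mod[OF c, of m] in auto)
  finally have *: "{y - ?d | y. (m mod k, y) \<in> B} = {z. lam m < z \<and> z \<le> c m}" .
  \<comment> \<open>Inserting \<open>lam m\<close> keeps the interval nonempty in rows that gain no
    box.\<close>
  have "insert (lam m) {z. lam m < z \<and> z \<le> c m} = {lam m .. c m}" using le[of m] by auto
  moreover have "Max {lam m .. c m} = c m" using le[of m] by (intro Max_eqI) auto
  ultimately show "add_boxes n k lam B m = c m" unfolding add_boxes_def * by simp
qed

section \<open>Row tableaux on canonical representatives\<close>

text \<open>The form of a tableau that is maintained between single bumping steps: the domain is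
  tied to the two shapes and rows weakly increase.\<close>

definition row_tab :: "int \<Rightarrow> ('a::linorder) tab \<Rightarrow> bool" where
  "row_tab k R \<longleftrightarrow>
     (\<forall>r y. ent R (r, y) \<noteq> None \<longleftrightarrow> 0 \<le> r \<and> r < k \<and> inner R r < y \<and> y \<le> outer R r) \<and>
     (\<forall>r y y' v v'. ent R (r, y) = Some v \<longrightarrow> ent R (r, y') = Some v' \<longrightarrow> y \<le> y' \<longrightarrow> v \<le> v')"

lemma row_tab_defined:
  "row_tab k R \<Longrightarrow> ent R (r, y) = Some v \<Longrightarrow> 0 \<le> r \<and> r < k \<and> inner R r < y \<and> y \<le> outer R r"
  unfolding row_tab_def by (metis option.distinct(1))

lemma row_tab_obtain:
  assumes "row_tab k R" "0 \<le> r" "r < k" "inner R r < y" "y \<le> outer R r"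
  obtains v where "ent R (r, y) = Some v"
proof -
  have "ent R (r, y) \<noteq> None" using assms unfolding row_tab_def by blast
  then show ?thesis using that by blast
qed

lemma row_tab_mono:
  "row_tab k R \<Longrightarrow> ent R (r, y) = Some v \<Longrightarrow> ent R (r, y') = Some v' \<Longrightarrow> y \<le> y' \<Longrightarrow> v \<le> v'"
  unfolding row_tab_def by blast

lemma row_tab_finite:
  assumes "row_tab k R" shows "finite {y. \<exists>v. ent R (r, y) = Some v \<and> p v}"
proof (rule finite_subset)
  show "{y. \<exists>v. ent R (r, y) = Some v \<and> p v} \<subseteq> {inner R r .. outer R r}"
    using row_tab_defined[OF assms] by force
qed simp

lemma row_tab_finite_boxes:
  assumes "row_tab k R" shows "finite {b. ent R b \<noteq> None}"
proof (rule finite_subset)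
  show "{b. ent R b \<noteq> None} \<subseteq> (\<Union>r\<in>{0..<k}. Pair r ` {inner R r .. outer R r})"
  proof
    fix b assume "b \<in> {b. ent R b \<noteq> None}"
    then obtain v where "ent R (fst b, snd b) = Some v" by auto
    from row_tab_defined[OF assms this]
    show "b \<in> (\<Union>r\<in>{0..<k}. Pair r ` {inner R r .. outer R r})"
      by (intro UN_I[of "fst b"] image_eqI[of _ _ "snd b"]) auto
  qed
qed simp

lemma row_tab_finite_ran:
  assumes "row_tab k R" shows "finite (ran (ent R))"
proof -
  have "ran (ent R) \<subseteq> (\<lambda>b. the (ent R b)) ` {b. ent R b \<noteq> None}"
    unfolding ran_def by (force simp: image_iff)
  then show ?thesis using row_tab_finite_boxes[OF assms] finite_surj by blast
qed

section \<open>Encoding of tableaux by chains of shapes\<close>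

text \<open>Defined by counting entries because the bumping invariant controls multiplicities of
  letters; \<open>level_iff\<close> turns the count back into positions.\<close>

definition level :: "int \<Rightarrow> ('a::linorder) tab \<Rightarrow> 'a list \<Rightarrow> nat \<Rightarrow> int \<Rightarrow> int" where
  "level k R xs j m =
     inner R m + int (card {y. \<exists>v. ent R (m mod k, y) = Some v \<and> v \<in> set (take j xs)})"

text \<open>The chain is required to be periodic and increasing at all indices, also beyond
  \<open>length xs\<close>, so that recursively defined chains such as \<open>bump_chain\<close> fit
  without truncation.\<close>

definition chain_tab :: "int \<Rightarrow> int \<Rightarrow> 'a list \<Rightarrow> (nat \<Rightarrow> int \<Rightarrow> int) \<Rightarrow> ('a::linorder) tab \<Rightarrow> bool" where
  "chain_tab n k xs G R \<longleftrightarrow>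
     (\<forall>j. periodic n k (G j)) \<and> (\<forall>j m. G j m \<le> G (Suc j) m) \<and>
     inner R = G 0 \<and> outer R = G (length xs) \<and>
     (\<forall>r y v. ent R (r, y) = Some v \<longleftrightarrow>
        0 \<le> r \<and> r < k \<and> (\<exists>j < length xs. v = xs ! j \<and> G j r < y \<and> y \<le> G (Suc j) r))"

text \<open>A chain fixes both shapes and all entries. This identifies the outputs of the two CRSK
  computations at the end.\<close>

lemma chain_tab_unique:
  assumes "chain_tab n k xs G R" "chain_tab n k xs G R'"
  shows "R = R'"
proof (rule tab.equality)
  show "ent R = ent R'"
  proof
    fix b
    have "\<And>v. ent R (fst b, snd b) = Some v \<longleftrightarrow> ent R' (fst b, snd b) = Some v"
      using assms unfolding chain_tab_def by metis
    then show "ent R b = ent R' b"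
      by (metis option.exhaust prod.collapse)
  qed
qed (use assms in \<open>auto simp: chain_tab_def\<close>)

text \<open>A nonempty set of this kind is the interval up to its maximum, and its cardinality then
  locates the maximum.\<close>

lemma initial_segment_card:
  fixes A :: "int set"
  assumes "A \<subseteq> {a<..b}" and "\<And>x y. y \<in> A \<Longrightarrow> a < x \<Longrightarrow> x \<le> y \<Longrightarrow> x \<in> A"
  shows "A = {a<..a + int (card A)}"
proof (cases "A = {}")
  case False
  have fin: "finite A" using assms(1) finite_subset by blast
  have MA: "Max A \<in> A" using fin False by simp
  have A: "A = {a<..Max A}"
  proof (intro set_eqI iffI)
    fix x assume "x \<in> A"
    then show "x \<in> {a<..Max A}" using fin assms(1) by auto
  next
    fix x assume "x \<in> {a<..Max A}"
    then show "x \<in> A" using assms(2)[OF MA, of x] by simp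
  qed
  have "a < Max A" using MA assms(1) by auto
  moreover have "card A = nat (Max A - a)" using arg_cong[OF A, of card] by simp
  ultimately have "a + int (card A) = Max A" by simp
  then show ?thesis using A by simp
qed simp

lemma level_Suc:
  assumes R: "row_tab k R" and xs: "distinct xs" and j: "j < length xs"
  shows "level k R xs (Suc j) m = level k R xs j m + int (card {y. ent R (m mod k, y) = Some (xs ! j)})"
proof -
  let ?A = "{y. \<exists>v. ent R (m mod k, y) = Some v \<and> v \<in> set (take j xs)}"
  let ?B = "{y. ent R (m mod k, y) = Some (xs ! j)}"
  have nin: "xs ! j \<notin> set (take j xs)"
    using xs j by (auto simp: in_set_conv_nth nth_eq_iff_index_eq)
  have "{y. \<exists>v. ent R (m mod k, y) = Some v \<and> v \<in> set (take (Suc j) xs)} = ?A \<union> ?B"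
    using j by (auto simp: take_Suc_conv_app_nth)
  moreover have "finite ?A" by (rule row_tab_finite[OF R])
  moreover have "finite ?B" using row_tab_finite[OF R, of "m mod k" "\<lambda>v. v = xs ! j"] by simp
  moreover have "?A \<inter> ?B = {}" using nin by auto
  ultimately show ?thesis unfolding level_def by (simp add: card_Un_disjoint)
qed

text \<open>Rows weakly increase, so the boxes holding one of the first \<open>j\<close> letters
  form an initial segment of the row, whose length is the count in \<open>level\<close>.\<close>

lemma level_iff:
  assumes R: "row_tab k R" and xs: "sorted_wrt (<) xs" "ran (ent R) \<subseteq> set xs"
    and r: "0 \<le> r" "r < k"
  shows "(\<exists>v. ent R (r, y) = Some v \<and> v \<in> set (take j xs)) \<longleftrightarrow> inner R r < y \<and> y \<le> level k R xs j r"
proof -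
  let ?A = "{y. \<exists>v. ent R (r, y) = Some v \<and> v \<in> set (take j xs)}"
  have "?A = {inner R r<..inner R r + int (card ?A)}"
  proof (rule initial_segment_card)
    show "?A \<subseteq> {inner R r<..outer R r}" using row_tab_defined[OF R] by fastforce
  next
    fix y z assume "z \<in> ?A" and y: "inner R r < y" "y \<le> z"
    then obtain v where v: "ent R (r, z) = Some v" "v \<in> set (take j xs)" by auto
    have "y \<le> outer R r" using row_tab_defined[OF R v(1)] y by simp
    then obtain w where w: "ent R (r, y) = Some w" using row_tab_obtain[OF R r y(1)] by blast
    have wv: "w \<le> v" using row_tab_mono[OF R w v(1) y(2)] .
    have "w \<in> set xs" using w xs(2) by (auto simp: ran_def)
    then obtain i where i: "i < length xs" "w = xs ! i" by (auto simp: in_set_conv_nth)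
    obtain i' where i': "i' < length xs" "i' < j" "v = xs ! i'" using v(2) by (auto simp: in_set_conv_nth)
    have "i \<le> i'"
    proof (rule ccontr)
      assume "\<not> i \<le> i'"
      then have "v < w" using i i' sorted_wrt_nth_less[OF xs(1), of i' i] by simp
      then show False using wv by simp
    qed
    then have "w = take j xs ! i \<and> i < length (take j xs)" using i i' by simp
    then have "w \<in> set (take j xs)" using nth_mem by blast
    then show "y \<in> ?A" using w by blast
  qed
  moreover have "r mod k = r" using r by simp
  ultimately have "?A = {inner R r<..level k R xs j r}" unfolding level_def by simp
  then have "y \<in> ?A \<longleftrightarrow> y \<in> {inner R r<..level k R xs j r}" by (rule arg_cong)
  then show ?thesis by simp
qed

text \<open>By \<open>level_iff\<close> the boxes with letter \<open>xs ! j\<close> are the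
  difference of two consecutive initial segments of the row.\<close>

lemma row_tab_chain_tab:
  assumes R: "row_tab k R" and k: "1 \<le> k"
    and per: "periodic n k (inner R)" "periodic n k (outer R)" and le: "\<And>m. inner R m \<le> outer R m"
    and xs: "sorted_wrt (<) xs" "ran (ent R) \<subseteq> set xs"
  shows "chain_tab n k xs (level k R xs) R"
proof -
  let ?L = "level k R xs"
  have pL: "periodic n k (?L j)" for j
    unfolding periodic_def
  proof
    fix m
    have "inner R m = inner R (m + k) + (n - k)" using per(1) unfolding periodic_def by blast
    then show "?L j m = ?L j (m + k) + (n - k)" by (simp add: level_def)
  qed
  have mono: "?L j m \<le> ?L (Suc j) m" for j m
  proof -
    have "card {y. \<exists>v. ent R (m mod k, y) = Some v \<and> v \<in> set (take j xs)}
        \<le> card {y. \<exists>v. ent R (m mod k, y) = Some v \<and> v \<in> set (take (Suc j) xs)}"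
      using set_take_subset_set_take[of j "Suc j" xs] by (intro card_mono row_tab_finite[OF R]) auto
    then show ?thesis by (simp add: level_def)
  qed
  have out: "outer R = ?L (length xs)"
  proof (rule periodic_ext[OF k per(2) pL])
    fix r assume r: "0 \<le> r" "r < k"
    have iff: "inner R r < y \<and> y \<le> ?L (length xs) r \<longleftrightarrow> inner R r < y \<and> y \<le> outer R r" for y
    proof -
      have "(\<exists>v. ent R (r, y) = Some v \<and> v \<in> set (take (length xs) xs)) \<longleftrightarrow> ent R (r, y) \<noteq> None"
        using xs(2) by (auto simp: ran_def)
      also have "\<dots> \<longleftrightarrow> inner R r < y \<and> y \<le> outer R r" using R r unfolding row_tab_def by blast
      finally show ?thesis using level_iff[OF R xs r] by blast
    qed
    have "inner R r \<le> ?L (length xs) r" by (simp add: level_def)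
    then show "outer R r = ?L (length xs) r" using le[of r] iff[of "outer R r"] iff[of "?L (length xs) r"] by linarith
  qed
  have ent: "ent R (r, y) = Some v \<longleftrightarrow>
        0 \<le> r \<and> r < k \<and> (\<exists>j < length xs. v = xs ! j \<and> ?L j r < y \<and> y \<le> ?L (Suc j) r)" for r y v
  proof (cases "0 \<le> r \<and> r < k")
    case True
    then have r: "0 \<le> r" "r < k" by auto
    have dist: "distinct xs" using xs(1) strict_sorted_iff by blast
    have base: "inner R r \<le> ?L j r" for j by (simp add: level_def)
    have at: "ent R (r, y) = Some (xs ! j) \<longleftrightarrow> ?L j r < y \<and> y \<le> ?L (Suc j) r" if j: "j < length xs" for j
    proof -
      have nin: "xs ! j \<notin> set (take j xs)"
        using dist j by (auto simp: in_set_conv_nth nth_eq_iff_index_eq)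
      have "ent R (r, y) = Some (xs ! j) \<longleftrightarrow>
          (\<exists>v. ent R (r, y) = Some v \<and> v \<in> set (take (Suc j) xs)) \<and>
          \<not> (\<exists>v. ent R (r, y) = Some v \<and> v \<in> set (take j xs))"
        using j nin by (auto simp: take_Suc_conv_app_nth)
      then show ?thesis using level_iff[OF R xs r, of y j] level_iff[OF R xs r, of y "Suc j"] base[of j] by auto
    qed
    have "ent R (r, y) = Some v \<Longrightarrow> v \<in> set xs" using xs(2) by (auto simp: ran_def)
    then show ?thesis using at r by (auto simp: in_set_conv_nth)
  next
    case False
    then show ?thesis using row_tab_defined[OF R] by blast
  qed
  have inn: "inner R = ?L 0" by (simp add: level_def fun_eq_iff)
  show ?thesis unfolding chain_tab_def by (intro conjI allI pL mono inn out ent)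
qed

section \<open>The bumping invariant\<close>

definition displaced :: "'a tab \<Rightarrow> 'a tab \<Rightarrow> int \<Rightarrow> int \<Rightarrow> 'a \<Rightarrow> bool" where
  "displaced R R' r y v \<longleftrightarrow> ent R (r, y) = Some v \<and> ent R' (r, y) \<noteq> Some v"

text \<open>\<open>R0\<close> is the tableau before the insertion, \<open>B\<close> the new inner shape.  An entry \<open>v\<close> with
  \<open>displaced R0 R r y v\<close> has been removed or bumped from its original place, one with
  \<open>displaced R R0 r y v\<close> has been inserted.\<close>

definition bump_inv ::
    "int \<Rightarrow> int \<Rightarrow> ('a::linorder) tab \<Rightarrow> (int \<Rightarrow> int) \<Rightarrow> 'a tab \<Rightarrow> ('a \<times> int) list \<Rightarrow> bool" where
  "bump_inv n k R0 B R q \<longleftrightarrow>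
     inner R = B \<and> periodic n k (outer R) \<and> row_tab k R \<and>
     (\<forall>m. outer R0 m \<le> outer R m) \<and> (\<forall>m. B m \<le> outer R m) \<and>
     (\<forall>r y v w. ent R (r, y) = Some v \<longrightarrow> ent R0 (r, y) = Some w \<longrightarrow> v \<le> w) \<and>
     (\<forall>r y v. displaced R R0 r y v \<longrightarrow> (\<exists>y'. displaced R0 R ((r - 1) mod k) y' v)) \<and>
     (\<forall>x s. (x, s) \<in> set q \<longrightarrow> 0 \<le> s \<and> s < k \<and> (\<exists>y'. displaced R0 R ((s - 1) mod k) y' x)) \<and>
     (\<forall>r y v x. displaced R R0 r y v \<longrightarrow> (x, r) \<in> set q \<longrightarrow> v \<le> x) \<and>
     sorted_wrt (\<lambda>p p'. snd p = snd p' \<longrightarrow> fst p \<le> fst p') q \<and>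
     (\<forall>r v. 0 \<le> r \<longrightarrow> r < k \<longrightarrow>
        card {y. ent R (r, y) = Some v} + card {y. displaced R0 R r y v} + count_list q (v, r) =
        card {y. ent R0 (r, y) = Some v} + card {y. displaced R0 R ((r - 1) mod k) y v})"

section \<open>Preservation of the invariant by one step\<close>

text \<open>The last clause of \<open>bump_inv\<close> is a balance: in each row, the present,
  departed and queued copies of a letter equal the original copies plus those departed from the
  preceding row. An append turns a queued copy of \<open>x\<close> into a present one. Its box lies
  beyond the original outer shape, so no original entry is displaced.\<close>

lemma fm_step_append:
  assumes k: "1 \<le> k" and R0: "row_tab k R0" and inv: "bump_inv n k R0 B R ((x, s) # q)"
    and max: "\<forall>y v. ent R (s, y) = Some v \<longrightarrow> v \<le> x"
    and R': "R' = R\<lparr> outer := add_boxes n k (outer R) {(s, outer R s + 1)}, ent := (ent R)((s, outer R s + 1) := Some x) \<rparr>"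
  shows "bump_inv n k R0 B R' q" "\<And>r y v. displaced R0 R' r y v \<longleftrightarrow> displaced R0 R r y v"
proof -
  let ?y = "outer R s + 1"
  note I = inv[unfolded bump_inv_def]
  have per: "periodic n k (outer R)" and R: "row_tab k R" and B: "inner R = B"
    and Ble: "\<And>m. B m \<le> outer R m" and ole: "\<And>m. outer R0 m \<le> outer R m" using I by auto
  have s: "0 \<le> s" "s < k" using I by auto
  \<comment> \<open>The outer shape after the append: one more box in each plane row congruent to
    \<open>s\<close> modulo \<open>k\<close>.\<close>
  define c where "c m = (if m mod k = s then outer R m + 1 else outer R m)" for m
  have pc: "periodic n k c"
    unfolding periodic_def
  proof
    fix m
    have "outer R m = outer R (m + k) + (n - k)" using per unfolding periodic_def by blast
    then show "c m = c (m + k) + (n - k)" by (simp add: c_def)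
  qed
  have outer': "outer R' = c"
  proof -
    have "add_boxes n k (outer R) {(s, ?y)} = c"
    proof (rule add_boxes_eq[OF k per pc])
      show "outer R m \<le> c m" for m by (simp add: c_def)
      show "(r, y) \<in> {(s, ?y)} \<longleftrightarrow> outer R r < y \<and> y \<le> c r" if "0 \<le> r" "r < k" for r y
        using that by (auto simp: c_def)
    qed
    then show ?thesis by (simp add: R')
  qed
  have ent': "ent R' b = (if b = (s, ?y) then Some x else ent R b)" for b by (simp add: R')
  have inner': "inner R' = B" by (simp add: R' B)
  have None: "ent R (s, ?y) = None" using row_tab_defined[OF R, of s ?y] by (cases "ent R (s, ?y)") auto
  have None0: "ent R0 (s, ?y) = None"
    using row_tab_defined[OF R0, of s ?y] ole[of s] by (cases "ent R0 (s, ?y)") auto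
  show dis: "displaced R0 R' r y v \<longleftrightarrow> displaced R0 R r y v" for r y v
    using None0 by (auto simp: displaced_def ent')
  have dis': "displaced R' R0 r y v \<longleftrightarrow> displaced R R0 r y v \<or> (r, y, v) = (s, ?y, x)" for r y v
    using None0 None by (auto simp: displaced_def ent')
  have R'_tab: "row_tab k R'"
    unfolding row_tab_def
  proof (intro conjI allI impI)
    fix r y
    have "ent R (r, y) \<noteq> None \<longleftrightarrow> 0 \<le> r \<and> r < k \<and> B r < y \<and> y \<le> outer R r"
      using R B unfolding row_tab_def by blast
    then show "ent R' (r, y) \<noteq> None \<longleftrightarrow> 0 \<le> r \<and> r < k \<and> inner R' r < y \<and> y \<le> outer R' r"
      unfolding inner' outer' ent' c_def using s Ble[of s] by auto
  next
    fix r y y' v v' assume *: "ent R' (r, y) = Some v" "ent R' (r, y') = Some v'" "y \<le> y'"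
    show "v \<le> v'"
    proof (cases "(r, y') = (s, ?y)")
      case True
      then show ?thesis using * max by (auto simp: ent' split: if_splits)
    next
      case False
      then have e: "ent R (r, y') = Some v'" using * by (auto simp: ent' split: if_splits)
      then have "(r, y) \<noteq> (s, ?y)" using row_tab_defined[OF R e] *(3) by auto
      then have "ent R (r, y) = Some v" using * by (auto simp: ent' split: if_splits)
      then show ?thesis using row_tab_mono[OF R _ e *(3)] by blast
    qed
  qed
  have fin: "finite {y. ent R (r, y) = Some v}" for r v
    using row_tab_finite[OF R, of r "\<lambda>w. w = v"] by simp
  have cnt: "card {y. ent R' (r, y) = Some v} = card {y. ent R (r, y) = Some v} + (if (v, r) = (x, s) then 1 else 0)" for r v
  proof (cases "(v, r) = (x, s)")
    case True
    then have "{y. ent R' (r, y) = Some v} = insert ?y {y. ent R (r, y) = Some v}" by (auto simp: ent')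
    then show ?thesis using True None fin by (simp add: card_insert_if)
  next
    case False
    then have "{y. ent R' (r, y) = Some v} = {y. ent R (r, y) = Some v}" using None by (auto simp: ent')
    then show ?thesis using False by auto
  qed
  \<comment> \<open>The queue is sorted among pairs with equal target row, so \<open>x\<close> is at
    most every value still to be inserted into row \<open>s\<close>.\<close>
  have srt: "\<And>z. (z, s) \<in> set q \<Longrightarrow> x \<le> z" "sorted_wrt (\<lambda>p p'. snd p = snd p' \<longrightarrow> fst p \<le> fst p') q"
    using I by auto
  have w1: "\<exists>y'. displaced R0 R ((s - 1) mod k) y' x" using I by simp
  show "bump_inv n k R0 B R' q"
    unfolding bump_inv_def dis dis'
  proof (intro conjI allI impI)
    show "outer R0 m \<le> outer R' m" "B m \<le> outer R' m" for m
      using ole[of m] Ble[of m] by (auto simp: outer' c_def)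
    show "v \<le> w" if "ent R' (r, y) = Some v" "ent R0 (r, y) = Some w" for r y v w
    proof -
      have "(r, y) \<noteq> (s, ?y)" using that None0 by auto
      then show ?thesis using that I by (auto simp: ent')
    qed
    show "\<exists>y'. displaced R0 R ((r - 1) mod k) y' v" if "displaced R R0 r y v \<or> (r, y, v) = (s, ?y, x)" for r y v
      using that w1 I by blast
    show "v \<le> z" if "displaced R R0 r y v \<or> (r, y, v) = (s, ?y, x)" "(z, r) \<in> set q" for r y v z
    proof (cases "(r, y, v) = (s, ?y, x)")
      case False
      then have "displaced R R0 r y v" using that(1) by blast
      moreover have "(z, r) \<in> set ((x, s) # q)" using that by simp
      ultimately show ?thesis using I by blast
    qed (use that srt in auto)
    show "0 \<le> t" "t < k" "\<exists>y'. displaced R0 R ((t - 1) mod k) y' z" if "(z, t) \<in> set q" for z t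
    proof -
      have "(z, t) \<in> set ((x, s) # q)" using that by simp
      then show "0 \<le> t" "t < k" "\<exists>y'. displaced R0 R ((t - 1) mod k) y' z" using I by blast+
    qed
    show "card {y. ent R' (r, y) = Some v} + card {y. displaced R0 R r y v} + count_list q (v, r) =
        card {y. ent R0 (r, y) = Some v} + card {y. displaced R0 R ((r - 1) mod k) y v}" if "0 \<le> r" "r < k" for r v
    proof -
      have "card {y. ent R (r, y) = Some v} + card {y. displaced R0 R r y v} + count_list ((x, s) # q) (v, r) =
        card {y. ent R0 (r, y) = Some v} + card {y. displaced R0 R ((r - 1) mod k) y v}"
        using I that by blast
      then show ?thesis unfolding cnt by (auto split: if_splits)
    qed
  qed (use inner' outer' pc R'_tab srt in auto)
qed

text \<open>The bumped \<open>x'\<close> exceeds \<open>x\<close> and hence all values inserted into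
  row \<open>s\<close> so far, so it is an original entry still in place. Thus exactly one
  displacement is added. Sortedness of the queue survives because bumped positions move to the
  right.\<close>

lemma fm_step_bump:
  assumes k: "1 \<le> k" and R0: "row_tab k R0" and inv: "bump_inv n k R0 B R ((x, s) # q)"
    and nmax: "\<not> (\<forall>y v. ent R (s, y) = Some v \<longrightarrow> v \<le> x)"
    and y: "y = Min {y. \<exists>v. ent R (s, y) = Some v \<and> x < v}"
    and x': "x' = the (ent R (s, y))"
    and R': "R' = R\<lparr> ent := (ent R)((s, y) := Some x) \<rparr>"
  shows "bump_inv n k R0 B R' (q @ [(x', (s + 1) mod k)])"
    and "\<And>r z v. displaced R0 R' r z v \<longleftrightarrow> displaced R0 R r z v \<or> (r, z, v) = (s, y, x')"
    and "ent R0 (s, y) = Some x'" "\<not> displaced R0 R s y x'"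
proof -
  let ?t = "(s + 1) mod k"
  note I = inv[unfolded bump_inv_def]
  have per: "periodic n k (outer R)" and R: "row_tab k R" and B: "inner R = B"
    and Ble: "\<And>m. B m \<le> outer R m" and ole: "\<And>m. outer R0 m \<le> outer R m"
    and ge: "\<And>r y v w. ent R (r, y) = Some v \<Longrightarrow> ent R0 (r, y) = Some w \<Longrightarrow> v \<le> w"
    and W1: "\<And>r y v. displaced R R0 r y v \<Longrightarrow> \<exists>y'. displaced R0 R ((r - 1) mod k) y' v"
    and W2: "\<And>z t. (z, t) \<in> set ((x, s) # q) \<Longrightarrow> 0 \<le> t \<and> t < k \<and> (\<exists>y'. displaced R0 R ((t - 1) mod k) y' z)"
    and M: "\<And>r y v z. displaced R R0 r y v \<Longrightarrow> (z, r) \<in> set ((x, s) # q) \<Longrightarrow> v \<le> z"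
    and C: "\<And>r v. 0 \<le> r \<Longrightarrow> r < k \<Longrightarrow>
        card {y. ent R (r, y) = Some v} + card {y. displaced R0 R r y v} + count_list ((x, s) # q) (v, r) =
        card {y. ent R0 (r, y) = Some v} + card {y. displaced R0 R ((r - 1) mod k) y v}"
    using I by blast+
  have s: "0 \<le> s" "s < k" using W2[of x s] by auto
  have t: "0 \<le> ?t" "?t < k" "(?t - 1) mod k = s" using k s by (auto simp: mod_diff_left_eq)
  let ?Y = "{y. \<exists>v. ent R (s, y) = Some v \<and> x < v}"
  have finY: "finite ?Y" by (rule row_tab_finite[OF R])
  have "?Y \<noteq> {}" using nmax by (auto simp: not_le)
  then have "y \<in> ?Y" unfolding y using finY by (rule Min_in[rotated])
  then have e: "ent R (s, y) = Some x'" and x: "x < x'" by (auto simp: x')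
  have left: "v \<le> x" if "ent R (s, z) = Some v" "z < y" for z v
  proof (rule ccontr)
    assume "\<not> v \<le> x"
    then have "z \<in> ?Y" using that(1) by auto
    then have "Min ?Y \<le> z" by (rule Min_le[OF finY])
    then show False using that(2) y by linarith
  qed
  \<comment> \<open>Entries inserted into row \<open>s\<close> are \<open>\<le> x\<close>, so the bumped entry is an original one.\<close>
  show e0: "ent R0 (s, y) = Some x'"
  proof (rule ccontr)
    assume "ent R0 (s, y) \<noteq> Some x'"
    then have "displaced R R0 s y x'" using e by (simp add: displaced_def)
    then show False using M[of s y x' x] x by simp
  qed
  show nd: "\<not> displaced R0 R s y x'" using e by (simp add: displaced_def)
  have ent': "ent R' b = (if b = (s, y) then Some x else ent R b)" for b by (simp add: R')
  have outer': "outer R' = outer R" and inner': "inner R' = B" by (simp_all add: R' B)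
  show dis: "displaced R0 R' r z v \<longleftrightarrow> displaced R0 R r z v \<or> (r, z, v) = (s, y, x')" for r z v
    using e e0 x by (auto simp: displaced_def ent')
  have dis': "displaced R' R0 r z v \<longleftrightarrow> displaced R R0 r z v \<or> (r, z, v) = (s, y, x)" for r z v
    using e e0 x by (auto simp: displaced_def ent')
  have R'_tab: "row_tab k R'"
    unfolding row_tab_def
  proof (intro conjI allI impI)
    fix r z
    have "ent R (r, z) \<noteq> None \<longleftrightarrow> 0 \<le> r \<and> r < k \<and> B r < z \<and> z \<le> outer R r"
      using R B unfolding row_tab_def by blast
    moreover have "ent R' (r, z) \<noteq> None \<longleftrightarrow> ent R (r, z) \<noteq> None" using e by (simp add: ent')
    ultimately show "ent R' (r, z) \<noteq> None \<longleftrightarrow> 0 \<le> r \<and> r < k \<and> inner R' r < z \<and> z \<le> outer R' r"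
      unfolding inner' outer' by blast
  next
    fix r z z' v v' assume *: "ent R' (r, z) = Some v" "ent R' (r, z') = Some v'" "z \<le> z'"
    consider "(r, z) = (s, y)" "(r, z') = (s, y)" | "(r, z) = (s, y)" "(r, z') \<noteq> (s, y)"
      | "(r, z) \<noteq> (s, y)" "(r, z') = (s, y)" | "(r, z) \<noteq> (s, y)" "(r, z') \<noteq> (s, y)" by blast
    then show "v \<le> v'"
    proof cases
      case 2
      then have "x' \<le> v'" using * row_tab_mono[OF R, of s y x' z' v'] e by (auto simp: ent' split: if_splits)
      then show ?thesis using 2 * x by (auto simp: ent' split: if_splits)
    next
      case 3
      then have "v \<le> x" using * left[of z v] by (auto simp: ent' split: if_splits)
      then show ?thesis using 3 * by (auto simp: ent' split: if_splits)
    next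
      case 4
      then have "ent R (r, z) = Some v" "ent R (r, z') = Some v'" using * by (auto simp: ent' split: if_splits)
      then show ?thesis using row_tab_mono[OF R _ _ *(3)] by blast
    qed (use * in \<open>auto simp: ent'\<close>)
  qed
  have fin: "finite {z. ent R (r, z) = Some v}" for r v
    using row_tab_finite[OF R, of r "\<lambda>w. w = v"] by simp
  have fin0: "finite {z. displaced R0 R r z v}" for r v
    by (rule finite_subset[OF _ row_tab_finite[OF R0, of r "\<lambda>w. w = v"]]) (auto simp: displaced_def)
  \<comment> \<open>A displaced position other than \<open>y\<close> lies to the left of
    \<open>y\<close>: if empty, it belongs to the new inner shape; if overwritten, it carries an
    inserted value, which is at most \<open>x\<close>. Monotonicity of the original row then bounds
    its old entry by \<open>x'\<close>.\<close>
  have out_le: "v \<le> x'" if d: "displaced R0 R' s z v" for z v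
  proof (cases "z = y")
    case True
    then show ?thesis using d e0 by (simp add: displaced_def)
  next
    case False
    have z0: "ent R0 (s, z) = Some v" and z: "ent R (s, z) \<noteq> Some v" using d False by (auto simp: displaced_def ent')
    have "z < y"
    proof (cases "ent R (s, z)")
      case None
      have "z \<le> outer R s" using row_tab_defined[OF R0 z0] ole[of s] by simp
      then have "z \<le> B s" using None row_tab_obtain[OF R s, of z] B by force
      then show ?thesis using row_tab_defined[OF R e] B by simp
    next
      case (Some w)
      then have "displaced R R0 s z w" using z z0 by (simp add: displaced_def)
      then have "w < x'" using M[of s z w x] x by simp
      then show ?thesis using row_tab_mono[OF R e Some] by (meson linorder_not_le)
    qed
    then show ?thesis using row_tab_mono[OF R0 z0 e0] by simp
  qed
  \<comment> \<open>Written with additions on both sides to avoid truncated subtraction of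
    naturals.\<close>
  have cnt: "card {z. ent R' (r, z) = Some v} + (if (v, r) = (x', s) then 1 else 0)
      = card {z. ent R (r, z) = Some v} + (if (v, r) = (x, s) then 1 else 0)" for r v
  proof -
    consider "(v, r) = (x', s)" | "(v, r) = (x, s)" | "(v, r) \<noteq> (x', s)" "(v, r) \<noteq> (x, s)" by blast
    then show ?thesis
    proof cases
      case 1
      then have "{z. ent R (r, z) = Some v} = insert y {z. ent R' (r, z) = Some v}"
        "y \<notin> {z. ent R' (r, z) = Some v}" using x e by (auto simp: ent')
      moreover from this(1) have "finite {z. ent R' (r, z) = Some v}" by (metis fin finite_insert)
      ultimately show ?thesis using 1 x by auto
    next
      case 2
      then have "{z. ent R' (r, z) = Some v} = insert y {z. ent R (r, z) = Some v}"
        "y \<notin> {z. ent R (r, z) = Some v}" using x e by (auto simp: ent')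
      then show ?thesis using 2 x fin by auto
    next
      case 3
      then have "{z. ent R' (r, z) = Some v} = {z. ent R (r, z) = Some v}" using e by (auto simp: ent')
      then show ?thesis using 3 by auto
    qed
  qed
  have dcnt: "card {z. displaced R0 R' r z v} = card {z. displaced R0 R r z v} + (if (v, r) = (x', s) then 1 else 0)" for r v
  proof (cases "(v, r) = (x', s)")
    case True
    then have "{z. displaced R0 R' r z v} = insert y {z. displaced R0 R r z v}" by (auto simp: dis)
    then show ?thesis using True nd fin0 by auto
  next
    case False
    then have "{z. displaced R0 R' r z v} = {z. displaced R0 R r z v}" by (auto simp: dis)
    then show ?thesis using False by auto
  qed
  have srt: "\<And>z. (z, s) \<in> set q \<Longrightarrow> x \<le> z" "sorted_wrt (\<lambda>p p'. snd p = snd p' \<longrightarrow> fst p \<le> fst p') q"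
    using I by auto
  have W1': "\<exists>y'. displaced R0 R' ((r - 1) mod k) y' v" if "displaced R' R0 r z v" for r z v
    using that W1[of r z v] W2[of x s] unfolding dis' dis by auto
  have W2': "0 \<le> t \<and> t < k \<and> (\<exists>y'. displaced R0 R' ((t - 1) mod k) y' z)"
    if "(z, t) \<in> set (q @ [(x', ?t)])" for z t
    using that W2[of z t] t unfolding dis by auto
  show "bump_inv n k R0 B R' (q @ [(x', ?t)])"
    unfolding bump_inv_def
  proof (intro conjI allI impI)
    show "outer R0 m \<le> outer R' m" "B m \<le> outer R' m" for m
      using ole[of m] Ble[of m] by (auto simp: outer')
    show "v \<le> w" if "ent R' (r, z) = Some v" "ent R0 (r, z) = Some w" for r z v w
      using that ge[of r z v w] e0 x by (auto simp: ent' split: if_splits)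
    show "v \<le> z'" if d: "displaced R' R0 r z v" and q: "(z', r) \<in> set (q @ [(x', ?t)])" for r z v z'
    proof (cases "(z', r) \<in> set q")
      case True
      show ?thesis
      proof (cases "(r, z, v) = (s, y, x)")
        case False
        then have "displaced R R0 r z v" using d dis' by blast
        then show ?thesis using M True by simp
      qed (use True srt in auto)
    next
      \<comment> \<open>A value inserted into row \<open>?t\<close> has a displaced source in row
        \<open>s\<close>, to which \<open>out_le\<close> applies. The source is taken with respect
        to \<open>R'\<close> because for \<open>k = 1\<close> the rows \<open>s\<close> and
        \<open>?t\<close> coincide and the value may be the \<open>x\<close> just inserted.\<close>
      case False
      then have "z' = x'" "r = ?t" using q by auto
      moreover obtain z'' where "displaced R0 R' ((r - 1) mod k) z'' v" using W1'[OF d] by blast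
      ultimately show ?thesis using t out_le by simp
    qed
    show "sorted_wrt (\<lambda>p p'. snd p = snd p' \<longrightarrow> fst p \<le> fst p') (q @ [(x', ?t)])"
    proof -
      \<comment> \<open>Pairs already queued for row \<open>?t\<close> also stem from displaced
        entries of row \<open>s\<close>, so the new pair may stand last.\<close>
      have "z \<le> x'" if "(z, ?t) \<in> set q" for z
      proof -
        have "(z, ?t) \<in> set ((x, s) # q)" using that by simp
        from W2[OF this] obtain y' where "displaced R0 R s y' z" using t by auto
        then show ?thesis using out_le dis by blast
      qed
      then show ?thesis using srt by (auto simp: sorted_wrt_append)
    qed
    show "card {z. ent R' (r, z) = Some v} + card {z. displaced R0 R' r z v} + count_list (q @ [(x', ?t)]) (v, r) =
        card {z. ent R0 (r, z) = Some v} + card {z. displaced R0 R' ((r - 1) mod k) z v}" if r: "0 \<le> r" "r < k" for r v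
    proof -
      \<comment> \<open>The new displacement counts on the left for row \<open>s\<close>, offsetting
        the lost copy of \<open>x'\<close>, and on the right for row \<open>?t\<close>, offsetting
        the new queue pair.\<close>
      have "(r - 1) mod k = s \<longleftrightarrow> r = ?t"
      proof
        assume "(r - 1) mod k = s"
        then have "?t = r mod k" by (metis diff_add_cancel mod_add_left_eq)
        then show "r = ?t" using r by simp
      qed (use t in simp)
      then show ?thesis using C[OF r, of v] cnt[of r v] dcnt[of r v] dcnt[of "(r - 1) mod k" v]
        by (auto split: if_splits)
    qed
    show "0 \<le> u" "u < k" "\<exists>y'. displaced R0 R' ((u - 1) mod k) y' z" if "(z, u) \<in> set (q @ [(x', ?t)])" for z u
      using W2'[OF that] by blast+
    show "\<exists>y'. displaced R0 R' ((r - 1) mod k) y' v" if "displaced R' R0 r z v" for r z v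
      using W1'[OF that] .
  qed (simp_all add: inner' outer' per R'_tab)
qed

section \<open>Initialisation and termination\<close>

lemma count_list_map_distinct:
  "distinct ys \<Longrightarrow> count_list (map f ys) z = card {y \<in> set ys. f y = z}"
proof (induction ys)
  case (Cons a ys)
  have "{y \<in> set (a # ys). f y = z} = (if f a = z then insert a {y \<in> set ys. f y = z} else {y \<in> set ys. f y = z})"
    by auto
  then show ?case using Cons by simp
qed simp

lemma count_list_concat_map:
  assumes "distinct hs" "h0 \<in> set hs" "\<And>h. h \<in> set hs \<Longrightarrow> h \<noteq> h0 \<Longrightarrow> z \<notin> set (f h)"
  shows "count_list (concat (map f hs)) z = count_list (f h0) z"
  using assms
proof (induction hs)
  case (Cons h hs)
  show ?case
  proof (cases "h = h0")
    case True
    then have "z \<notin> set (concat (map f hs))" using Cons.prems by auto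
    then show ?thesis using True by simp
  next
    case False
    then have "count_list (f h) z = 0" using Cons.prems by simp
    then show ?thesis using Cons False by simp
  qed
qed simp

lemma sorted_wrt_concat_map:
  assumes "distinct hs" "\<And>h. h \<in> set hs \<Longrightarrow> sorted_wrt P (f h)"
    and "\<And>h h' p p'. h \<in> set hs \<Longrightarrow> h' \<in> set hs \<Longrightarrow> h \<noteq> h' \<Longrightarrow> p \<in> set (f h) \<Longrightarrow> p' \<in> set (f h') \<Longrightarrow> P p p'"
  shows "sorted_wrt P (concat (map f hs))"
  using assms
proof (induction hs)
  case (Cons h hs)
  have "sorted_wrt P (concat (map f hs))"
  proof (rule Cons.IH)
    show "P p p'" if "h1 \<in> set hs" "h2 \<in> set hs" "h1 \<noteq> h2" "p \<in> set (f h1)" "p' \<in> set (f h2)" for h1 h2 p p'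
      by (rule Cons.prems(3)[of h1 h2]) (use that in auto)
  qed (use Cons.prems in auto)
  moreover have "P p p'" if p: "p \<in> set (f h)" "p' \<in> set (concat (map f hs))" for p p'
  proof -
    obtain h' where "h' \<in> set hs" "p' \<in> set (f h')" using p(2) by auto
    then show ?thesis using Cons.prems(1) Cons.prems(3)[of h h' p p'] p by auto
  qed
  ultimately show ?case using Cons.prems(2)[of h] by (simp add: sorted_wrt_append)
qed simp

text \<open>Queue pairs store the target row while the invariant speaks of the source row; this
  translates between the two.\<close>

lemma succ_mod_eq_iff:
  fixes k :: int
  assumes "0 \<le> h" "h < k" "0 \<le> r" "r < k"
  shows "(h + 1) mod k = r \<longleftrightarrow> h = (r - 1) mod k"
proof
  assume "(h + 1) mod k = r"
  then have "(r - 1) mod k = h mod k" by (metis add_diff_cancel_right' mod_diff_left_eq)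
  then show "h = (r - 1) mod k" using assms by simp
next
  assume "h = (r - 1) mod k"
  then have "(h + 1) mod k = r mod k" by (metis diff_add_cancel mod_add_left_eq)
  then show "(h + 1) mod k = r" using assms by simp
qed

lemma periodic_max:
  assumes "periodic n k f" "periodic n k g"
  shows "periodic n k (\<lambda>m. max (f m) (g m))"
  unfolding periodic_def
proof
  fix m
  have "f m = f (m + k) + (n - k)" "g m = g (m + k) + (n - k)" using assms unfolding periodic_def by blast+
  then show "max (f m) (g m) = max (f (m + k)) (g (m + k)) + (n - k)" by linarith
qed

text \<open>At the start nothing is inserted, and the displaced entries are those on boxes of
  \<open>S\<close>. Each is queued once for the next row, which gives the balance; going from left
  to right makes the values of one row increase weakly.\<close>

lemma bump_inv_init:
  assumes k: "1 \<le> k" and R0: "row_tab k R0"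
    and per: "periodic n k (inner R0)" "periodic n k (outer R0)" and io: "\<And>m. inner R0 m \<le> outer R0 m"
    and B: "periodic n k B" "\<And>m. inner R0 m \<le> B m"
    and S: "\<And>r y. (r, y) \<in> S \<longleftrightarrow> 0 \<le> r \<and> r < k \<and> inner R0 r < y \<and> y \<le> B r"
  shows "bump_inv n k R0 B (fm_init n k R0 S) (fm_queue0 k R0 S)"
proof -
  let ?R = "fm_init n k R0 S"
  let ?Y = "\<lambda>h. {y. (h, y) \<in> S \<and> y \<le> outer R0 h}"
  let ?f = "\<lambda>h. map (\<lambda>y. (the (ent R0 (h, y)), (h + 1) mod k)) (sorted_list_of_set (?Y h))"
  have q: "fm_queue0 k R0 S = concat (map ?f [0..k - 1])" by (simp add: fm_queue0_def)
  \<comment> \<open>The boxes of \<open>S\<close> outside the old outer shape enlarge it to the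
    pointwise maximum with \<open>B\<close>.\<close>
  have "add_boxes n k (outer R0) {b \<in> S. outer R0 (fst b) < snd b} = (\<lambda>m. max (outer R0 m) (B m))"
    by (rule add_boxes_eq[OF k per(2) periodic_max[OF per(2) B(1)]])
      (use io in \<open>auto simp: S intro: le_less_trans\<close>)
  then have outer: "outer ?R = (\<lambda>m. max (outer R0 m) (B m))" by (simp add: fm_init_def)
  have "add_boxes n k (inner R0) S = B"
    by (rule add_boxes_eq[OF k per(1) B]) (auto simp: S)
  then have inner: "inner ?R = B" by (simp add: fm_init_def)
  have ent: "ent ?R b = (if b \<in> S then None else ent R0 b)" for b by (simp add: fm_init_def)
  have dis: "displaced R0 ?R r y v \<longleftrightarrow> ent R0 (r, y) = Some v \<and> (r, y) \<in> S" for r y v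
    by (auto simp: displaced_def ent)
  have dis': "\<not> displaced ?R R0 r y v" for r y v
    by (auto simp: displaced_def ent)
  have finY: "finite (?Y h)" for h
    by (rule finite_subset[of _ "{inner R0 h..outer R0 h}"]) (auto simp: S)
  have Yent: "ent R0 (h, y) = Some (the (ent R0 (h, y)))" if "y \<in> ?Y h" for h y
    using that row_tab_obtain[OF R0, of h y] by (force simp: S)
  have Rtab: "row_tab k ?R"
    unfolding row_tab_def
  proof (intro conjI allI impI)
    fix r y
    have "ent R0 (r, y) \<noteq> None \<longleftrightarrow> 0 \<le> r \<and> r < k \<and> inner R0 r < y \<and> y \<le> outer R0 r"
      using R0 unfolding row_tab_def by blast
    then show "ent ?R (r, y) \<noteq> None \<longleftrightarrow> 0 \<le> r \<and> r < k \<and> inner ?R r < y \<and> y \<le> outer ?R r"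
      unfolding inner outer ent using S B(2)[of r] by auto
  next
    fix r y y' v v'
    assume "ent ?R (r, y) = Some v" "ent ?R (r, y') = Some v'" "y \<le> y'"
    then show "v \<le> v'" using row_tab_mono[OF R0] by (auto simp: ent split: if_splits)
  qed
  have setq: "0 \<le> t \<and> t < k \<and> (\<exists>y'. displaced R0 ?R ((t - 1) mod k) y' x)" if "(x, t) \<in> set (fm_queue0 k R0 S)" for x t
  proof -
    have "\<exists>h \<in> set [0..k - 1]. (x, t) \<in> set (?f h)" using that unfolding q by simp
    then obtain h where h: "0 \<le> h" "h < k" and "(x, t) \<in> set (?f h)" by auto
    then have "(x, t) \<in> (\<lambda>y. (the (ent R0 (h, y)), (h + 1) mod k)) ` ?Y h" using finY[of h] by simp
    then obtain y where y: "y \<in> ?Y h" and xt: "x = the (ent R0 (h, y))" "t = (h + 1) mod k" by blast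
    have t: "0 \<le> t" "t < k" using k xt by auto
    then have "h = (t - 1) mod k" using succ_mod_eq_iff[OF h t] xt by simp
    then show ?thesis using t Yent[OF y] y xt by (auto simp: dis)
  qed
  have srt: "sorted_wrt (\<lambda>p p'. snd p = snd p' \<longrightarrow> fst p \<le> fst p') (fm_queue0 k R0 S)"
    unfolding q
  proof (rule sorted_wrt_concat_map)
    fix h
    have "sorted_wrt (\<lambda>y y'. the (ent R0 (h, y)) \<le> the (ent R0 (h, y'))) (sorted_list_of_set (?Y h))"
    proof (rule sorted_wrt_mono_rel)
      show "sorted_wrt (<) (sorted_list_of_set (?Y h))" by (rule strict_sorted_list_of_set)
      show "the (ent R0 (h, y)) \<le> the (ent R0 (h, y'))"
        if "y \<in> set (sorted_list_of_set (?Y h))" "y' \<in> set (sorted_list_of_set (?Y h))" "y < y'" for y y'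
        using that finY row_tab_mono[OF R0 Yent Yent, of y h y'] by simp
    qed
    then show "sorted_wrt (\<lambda>p p'. snd p = snd p' \<longrightarrow> fst p \<le> fst p') (?f h)"
      by (simp add: sorted_wrt_map)
  next
    fix h h' p p' assume *: "h \<in> set [0..k - 1]" "h' \<in> set [0..k - 1]" "h \<noteq> h'" "p \<in> set (?f h)" "p' \<in> set (?f h')"
    \<comment> \<open>Distinct rows have distinct target rows, so the order condition between their
      blocks is vacuous.\<close>
    have "(h + 1) mod k \<noteq> (h' + 1) mod k"
      using * k succ_mod_eq_iff[of h k "(h' + 1) mod k"] succ_mod_eq_iff[of h' k "(h' + 1) mod k"] by auto
    then show "snd p = snd p' \<longrightarrow> fst p \<le> fst p'" using * by auto
  qed simp
  have cntq: "count_list (fm_queue0 k R0 S) (v, r) = card {y. displaced R0 ?R ((r - 1) mod k) y v}"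
    if r: "0 \<le> r" "r < k" for r v
  proof -
    let ?h = "(r - 1) mod k"
    have h: "0 \<le> ?h" "?h < k" using k by simp_all
    have "count_list (fm_queue0 k R0 S) (v, r) = count_list (?f ?h) (v, r)"
      unfolding q
    proof (rule count_list_concat_map)
      show "?h \<in> set [0..k - 1]" using h by simp
      show "(v, r) \<notin> set (?f h)" if "h \<in> set [0..k - 1]" "h \<noteq> ?h" for h
        using that succ_mod_eq_iff[of h k r] r by auto
    qed simp
    also have "\<dots> = card {y \<in> ?Y ?h. (the (ent R0 (?h, y)), (?h + 1) mod k) = (v, r)}"
      using finY by (subst count_list_map_distinct) simp_all
    also have "{y \<in> ?Y ?h. (the (ent R0 (?h, y)), (?h + 1) mod k) = (v, r)} = {y. displaced R0 ?R ?h y v}"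
    proof (intro set_eqI iffI)
      fix y assume "y \<in> {y \<in> ?Y ?h. (the (ent R0 (?h, y)), (?h + 1) mod k) = (v, r)}"
      then show "y \<in> {y. displaced R0 ?R ?h y v}" using Yent[of y ?h] by (simp add: dis)
    next
      fix y assume "y \<in> {y. displaced R0 ?R ?h y v}"
      then have y: "ent R0 (?h, y) = Some v" "(?h, y) \<in> S" by (simp_all add: dis)
      then show "y \<in> {y \<in> ?Y ?h. (the (ent R0 (?h, y)), (?h + 1) mod k) = (v, r)}"
        using row_tab_defined[OF R0 y(1)] succ_mod_eq_iff[OF h r] by simp
    qed
    finally show ?thesis .
  qed
  show ?thesis
    unfolding bump_inv_def
  proof (intro conjI allI impI)
    show "v \<le> w" if "ent ?R (r, y) = Some v" "ent R0 (r, y) = Some w" for r y v w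
      using that by (auto simp: ent split: if_splits)
    show "card {y. ent ?R (r, y) = Some v} + card {y. displaced R0 ?R r y v} + count_list (fm_queue0 k R0 S) (v, r) =
        card {y. ent R0 (r, y) = Some v} + card {y. displaced R0 ?R ((r - 1) mod k) y v}"
      if r: "0 \<le> r" "r < k" for r v
    proof -
      have "{y. ent R0 (r, y) = Some v} = {y. ent ?R (r, y) = Some v} \<union> {y. displaced R0 ?R r y v}"
        "{y. ent ?R (r, y) = Some v} \<inter> {y. displaced R0 ?R r y v} = {}"
        by (auto simp: ent dis split: if_splits)
      moreover have "finite {y. ent R0 (r, y) = Some v}"
        using row_tab_finite[OF R0, of r "\<lambda>w. w = v"] by simp
      ultimately have "card {y. ent R0 (r, y) = Some v} = card {y. ent ?R (r, y) = Some v} + card {y. displaced R0 ?R r y v}"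
        by (metis card_Un_disjoint finite_Un)
      then show ?thesis using cntq[OF r] by simp
    qed
    show "0 \<le> t" "t < k" "\<exists>y'. displaced R0 ?R ((t - 1) mod k) y' x" if "(x, t) \<in> set (fm_queue0 k R0 S)" for x t
      using setq[OF that] by blast+
  qed (use dis' in \<open>auto simp: inner outer Rtab srt periodic_max per B\<close>)
qed

text \<open>\<open>M R\<close> collects the original entries that have not left their place: a bump removes one of
  them and keeps the queue length, an append shortens the queue.\<close>

lemma fm_step_inv:
  assumes k: "1 \<le> k" and R0: "row_tab k R0" and inv: "bump_inv n k R0 B R q" and q: "q \<noteq> []"
    and M: "\<And>R. M R = {(r, y, v). ent R0 (r, y) = Some v \<and> \<not> displaced R0 R r y v}"
    and step: "fm_step n k (R, q) = (R', q')"
  shows "bump_inv n k R0 B R' q' \<and> card (M R') + length q' < card (M R) + length q"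
proof -
  obtain x s p where qs: "q = (x, s) # p" using q by (cases q) auto
  note inv' = inv[unfolded qs]
  have fin: "finite (M R)"
  proof (rule finite_subset)
    show "M R \<subseteq> (\<lambda>b. (fst b, snd b, the (ent R0 b))) ` {b. ent R0 b \<noteq> None}"
      unfolding M by force
  qed (use row_tab_finite_boxes[OF R0] in simp)
  show ?thesis
  proof (cases "\<forall>y v. ent R (s, y) = Some v \<longrightarrow> v \<le> x")
    case True
    then have R': "R' = R\<lparr> outer := add_boxes n k (outer R) {(s, outer R s + 1)}, ent := (ent R)((s, outer R s + 1) := Some x) \<rparr>"
      and q': "q' = p" using step qs by (auto simp: Let_def)
    note A = fm_step_append[OF k R0 inv' True R']
    have "M R' = M R" unfolding M A(2) ..
    then show ?thesis using A(1) qs q' by simp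
  next
    case False
    define y where "y = Min {y. \<exists>v. ent R (s, y) = Some v \<and> x < v}"
    define x' where "x' = the (ent R (s, y))"
    have "fm_step n k (R, q) = (R\<lparr> ent := (ent R)((s, y) := Some x) \<rparr>, p @ [(x', (s + 1) mod k)])"
      unfolding qs fm_step.simps if_not_P[OF False] Let_def x'_def y_def ..
    then have R': "R' = R\<lparr> ent := (ent R)((s, y) := Some x) \<rparr>"
      and q': "q' = p @ [(x', (s + 1) mod k)]" using step by auto
    note A = fm_step_bump[OF k R0 inv' False y_def x'_def R']
    have "M R' = M R - {(s, y, x')}" unfolding M A(2) by auto
    moreover have "(s, y, x') \<in> M R" using A(3,4) by (simp add: M)
    ultimately have "card (M R') < card (M R)" using fin by (metis card_Diff1_less)
    then show ?thesis using A(1) qs q' by simp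
  qed
qed

section \<open>Termination of full multi-insertion\<close>

text \<open>The measure of \<open>fm_step_inv\<close> decreases, so \<open>while_option\<close>
  returns a state; it inherits the invariant with an empty queue, and the balance then has no queued
  copies.\<close>

lemma FullMulti_terminates:
  assumes k: "1 \<le> k" and R0: "row_tab k R0"
    and inv: "bump_inv n k R0 B (fm_init n k R0 S) (fm_queue0 k R0 S)"
  obtains R' where "FullMulti n k R0 S = Some R'" "bump_inv n k R0 B R' []"
proof -
  define M where "M R = {(r, y, v). ent R0 (r, y) = Some v \<and> \<not> displaced R0 R r y v}" for R
  let ?P = "\<lambda>(R, q). bump_inv n k R0 B R q"
  let ?b = "\<lambda>(R', q). q \<noteq> ([] :: ('a \<times> int) list)"
  have step: "?P (fm_step n k st) \<and>
      (\<lambda>(R, q). card (M R) + length q) (fm_step n k st) < (\<lambda>(R, q). card (M R) + length q) st"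
    if "?P st" "?b st" for st
    using that fm_step_inv[OF k R0 _ _ M_def] by (cases st; cases "fm_step n k st") auto
  have init: "?P (fm_init n k R0 S, fm_queue0 k R0 S)" using inv by simp
  obtain st where st: "while_option ?b (fm_step n k) (fm_init n k R0 S, fm_queue0 k R0 S) = Some st"
    using measure_while_option_Some[where P = ?P and b = ?b and f = "\<lambda>(R, q). card (M R) + length q", OF step init] by blast
  have "?P st" by (rule while_option_rule[OF _ st]) (use step init in auto)
  moreover have "\<not> ?b st" using while_option_stop[OF st] .
  ultimately have "bump_inv n k R0 B (fst st) []" by (cases st) auto
  moreover have "FullMulti n k R0 S = Some (fst st)" unfolding FullMulti_def using st by simp
  ultimately show ?thesis using that by blast
qed

section \<open>The local rule and its growth diagram\<close>

text \<open>The piecewise linear local rule of RSK growth diagrams. On periodic shapes the index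
  \<open>m - 1\<close> wraps around the cylinder.\<close>

fun bump_chain :: "(nat \<Rightarrow> int \<Rightarrow> int) \<Rightarrow> (int \<Rightarrow> int) \<Rightarrow> nat \<Rightarrow> int \<Rightarrow> int" where
  "bump_chain G B 0 m = B m"
| "bump_chain G B (Suc j) m =
     max (G (Suc j) m) (bump_chain G B j m) + min (G (Suc j) (m - 1)) (bump_chain G B j (m - 1)) - G j (m - 1)"

text \<open>By induction both arguments of the \<open>min\<close> are at least
  \<open>G j (m - 1)\<close>, so the terms after the \<open>max\<close> add a nonnegative
  amount.\<close>

lemma bump_chain_ge:
  assumes "\<And>j m. G j m \<le> G (Suc j) m" "\<And>m. G 0 m \<le> B m"
  shows "G j m \<le> bump_chain G B j m"
proof (induction j arbitrary: m)
  case (Suc j)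
  show ?case using Suc[of "m - 1"] assms(1)[of j "m - 1"] by simp
qed (use assms in simp)

lemma bump_chain_mono:
  assumes "\<And>j m. G j m \<le> G (Suc j) m" "\<And>m. G 0 m \<le> B m"
  shows "bump_chain G B j m \<le> bump_chain G B (Suc j) m"
  using bump_chain_ge[of G B, OF assms, of j "m - 1"] assms(1)[of j "m - 1"] by simp

lemma bump_chain_periodic:
  assumes "\<And>j. periodic n k (G j)" "periodic n k B"
  shows "periodic n k (bump_chain G B j)"
proof (induction j)
  case 0
  have "bump_chain G B 0 = B" by (simp add: fun_eq_iff)
  then show ?case using assms by simp
next
  case (Suc j)
  show ?case
    unfolding periodic_def
  proof
    fix m
    have *: "m + k - 1 = m - 1 + k" by simp
    have "f m = f (m + k) + (n - k)" "f (m - 1) = f (m - 1 + k) + (n - k)" if "periodic n k f" for f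
      using that unfolding periodic_def by blast+
    note this[OF assms(1)[of "Suc j"]] this[OF assms(1)[of j]] this[OF Suc]
    then show "bump_chain G B (Suc j) m = bump_chain G B (Suc j) (m + k) + (n - k)"
      unfolding bump_chain.simps * by linarith
  qed
qed

lemma chain_cover:
  fixes G :: "nat \<Rightarrow> int"
  assumes "\<And>j. G j \<le> G (Suc j)"
  shows "G 0 < y \<and> y \<le> G p \<longleftrightarrow> (\<exists>j < p. G j < y \<and> y \<le> G (Suc j))"
proof (induction p)
  case (Suc p)
  have "G 0 \<le> G p" by (rule lift_Suc_mono_le[of G, OF assms]) simp
  then show ?case using Suc assms[of p] by (auto simp: less_Suc_eq)
qed simp

lemma chain_unique_index:
  fixes G :: "nat \<Rightarrow> int"
  assumes "\<And>j. G j \<le> G (Suc j)" "G i < y" "y' \<le> G (Suc j)" "y \<le> y'"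
  shows "i \<le> j"
proof (rule ccontr)
  assume "\<not> i \<le> j"
  then have "G (Suc j) \<le> G i" by (intro lift_Suc_mono_le[of G, OF assms(1)]) simp
  then show False using assms by simp
qed

lemma chain_tab_row_tab:
  assumes G: "chain_tab n k xs G R" and xs: "sorted_wrt (<) xs"
  shows "row_tab k R"
  unfolding row_tab_def
proof (intro conjI allI impI)
  fix r y
  have "ent R (r, y) \<noteq> None \<longleftrightarrow> (\<exists>v. ent R (r, y) = Some v)" by auto
  also have "\<dots> \<longleftrightarrow> 0 \<le> r \<and> r < k \<and> (\<exists>j < length xs. G j r < y \<and> y \<le> G (Suc j) r)"
    using G unfolding chain_tab_def by blast
  also have "\<dots> \<longleftrightarrow> 0 \<le> r \<and> r < k \<and> inner R r < y \<and> y \<le> outer R r"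
    using G chain_cover[of "\<lambda>j. G j r" y "length xs"] unfolding chain_tab_def by simp
  finally show "ent R (r, y) \<noteq> None \<longleftrightarrow> 0 \<le> r \<and> r < k \<and> inner R r < y \<and> y \<le> outer R r" .
next
  fix r y y' v v' assume *: "ent R (r, y) = Some v" "ent R (r, y') = Some v'" "y \<le> y'"
  obtain i where i: "i < length xs" "v = xs ! i" "G i r < y"
    using G *(1) unfolding chain_tab_def by blast
  obtain j where j: "j < length xs" "v' = xs ! j" "y' \<le> G (Suc j) r"
    using G *(2) unfolding chain_tab_def by blast
  have "i \<le> j"
    using chain_unique_index[of "\<lambda>j. G j r" i y y' j] G i j *(3) unfolding chain_tab_def by blast
  then show "v \<le> v'" using sorted_wrt_nth_less[OF xs, of i j] i j by (cases "i = j") auto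
qed

lemma chain_tab_ent_iff:
  assumes G: "chain_tab n k xs G R" and xs: "distinct xs" and j: "j < length xs"
  shows "ent R (r, y) = Some (xs ! j) \<longleftrightarrow> 0 \<le> r \<and> r < k \<and> G j r < y \<and> y \<le> G (Suc j) r"
proof -
  have "ent R (r, y) = Some (xs ! j) \<longleftrightarrow>
      0 \<le> r \<and> r < k \<and> (\<exists>i < length xs. xs ! j = xs ! i \<and> G i r < y \<and> y \<le> G (Suc i) r)"
    using G unfolding chain_tab_def by blast
  then show ?thesis using xs j nth_eq_iff_index_eq by blast
qed

text \<open>Shapes and entries only involve indices up to \<open>length xs\<close>. This lets a
  \<open>level\<close> chain be exchanged for a \<open>bump_chain\<close>, with which it is compared
  only there.\<close>

lemma chain_tab_cong:
  assumes "chain_tab n k xs G R" and "\<And>j. j \<le> length xs \<Longrightarrow> G j = H j"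
    and "\<And>j. periodic n k (H j)" "\<And>j m. H j m \<le> H (Suc j) m"
  shows "chain_tab n k xs H R"
proof -
  have "(\<exists>j < length xs. v = xs ! j \<and> G j r < y \<and> y \<le> G (Suc j) r) \<longleftrightarrow>
      (\<exists>j < length xs. v = xs ! j \<and> H j r < y \<and> y \<le> H (Suc j) r)" for r y v
    using assms(2) by (metis Suc_leI less_imp_le)
  then show ?thesis using assms unfolding chain_tab_def by simp
qed

lemma in_set_take_iff: "v \<in> set (take j xs) \<longleftrightarrow> (\<exists>i < j. i < length xs \<and> v = xs ! i)"
  by (metis in_set_conv_nth length_take min_less_iff_conj nth_take)

section \<open>Full multi-insertion obeys the local rule\<close>

text \<open>Induction over the letters. With an empty queue, the balance gives the final number of
  copies of \<open>xs ! j\<close> in a row as original minus departed plus arrived. The departed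
  copies number the \<open>min\<close> of the two shapes minus \<open>G j\<close>, and a sum minus a
  \<open>min\<close> is the \<open>max\<close>.\<close>

lemma bump_inv_final_level:
  assumes k: "1 \<le> k" and G: "chain_tab n k xs G R" and xs: "sorted_wrt (<) xs"
    and B: "periodic n k B" "\<And>m. G 0 m \<le> B m"
    and inv: "bump_inv n k R B R' []" and ran: "ran (ent R') \<subseteq> set xs"
    and j: "j \<le> length xs" and r: "0 \<le> r" "r < k"
  shows "level k R' xs j r = bump_chain G B j r"
  using j r
proof (induction j arbitrary: r)
  case 0
  then show ?case using inv by (simp add: level_def bump_inv_def)
next
  case (Suc j)
  let ?N = "bump_chain G B"
  let ?a = "xs ! j"
  have dist: "distinct xs" using xs strict_sorted_iff by blast
  have R': "row_tab k R'" and inn: "inner R' = B" and out: "\<And>m. outer R m \<le> outer R' m"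
    and ge: "\<And>r y v w. ent R' (r, y) = Some v \<Longrightarrow> ent R (r, y) = Some w \<Longrightarrow> v \<le> w"
    using inv unfolding bump_inv_def by blast+
  have perG: "periodic n k (G j)" for j using G by (simp add: chain_tab_def)
  have mono: "G j m \<le> G (Suc j) m" for j m using G by (simp add: chain_tab_def)
  have GN: "G j m \<le> ?N j m" for m by (rule bump_chain_ge[OF mono B(2)])
  have perN: "periodic n k (?N j)" by (rule bump_chain_periodic[OF perG B(1)])
  have jl: "j < length xs" using Suc.prems by simp
  have nin: "?a \<notin> set (take j xs)"
    using dist jl by (auto simp: in_set_conv_nth nth_eq_iff_index_eq)
  have orig: "int (card {y. ent R (t, y) = Some ?a}) = G (Suc j) t - G j t" if t: "0 \<le> t" "t < k" for t
  proof -
    have "{y. ent R (t, y) = Some ?a} = {G j t<..G (Suc j) t}"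
      using chain_tab_ent_iff[OF G dist jl] t by auto
    then show ?thesis using mono[of j t] by simp
  qed
  \<comment> \<open>An original \<open>?a\<close> has left its box iff the box now holds a smaller
    letter or lies in the new inner shape, that is, iff its position is at most
    \<open>?N j t\<close>.\<close>
  have disp: "int (card {y. displaced R R' t y ?a}) = min (G (Suc j) t) (?N j t) - G j t" if t: "0 \<le> t" "t < k" for t
  proof -
    have lev: "(\<exists>v. ent R' (t, y) = Some v \<and> v \<in> set (take j xs)) \<longleftrightarrow> B t < y \<and> y \<le> ?N j t" for y
      using level_iff[OF R' xs ran t, of y j] Suc.IH[OF _ t] jl inn by simp
    have dis: "displaced R R' t y ?a \<longleftrightarrow> G j t < y \<and> y \<le> min (G (Suc j) t) (?N j t)" for y
    proof (cases "ent R (t, y) = Some ?a")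
      case True
      then have y: "G j t < y" "y \<le> G (Suc j) t" using chain_tab_ent_iff[OF G dist jl] by auto
      have BN: "B t \<le> ?N j t"
        using lift_Suc_mono_le[of "\<lambda>j. ?N j t" 0 j] bump_chain_mono[of G B, OF mono B(2)] by simp
      have "ent R' (t, y) \<noteq> Some ?a \<longleftrightarrow> y \<le> ?N j t"
      proof (cases "y \<le> B t")
        case True
        then have "ent R' (t, y) = None" using row_tab_defined[OF R', of t y] inn by (cases "ent R' (t, y)") auto
        then show ?thesis using True BN by simp
      next
        case False
        have "y \<le> outer R' t"
          using row_tab_defined[OF chain_tab_row_tab[OF G xs] True] out[of t] by simp
        then obtain w where w: "ent R' (t, y) = Some w" using row_tab_obtain[OF R' t] False inn by force
        have "w \<in> set xs" using ran w by (auto simp: ran_def)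
        then obtain i where i: "i < length xs" "w = xs ! i" by (auto simp: in_set_conv_nth)
        have wle: "w \<le> ?a" using ge[OF w True] .
        \<comment> \<open>Values in a box never increase during bumping, so a different letter there
          is an earlier one.\<close>
        have "i \<le> j" using sorted_wrt_nth_less[OF xs, of j i] i wle by force
        then have "w \<noteq> ?a \<longleftrightarrow> w \<in> set (take j xs)"
          using i nin jl unfolding in_set_take_iff by (metis le_neq_implies_less)
        then show ?thesis using lev[of y] w False by auto
      qed
      then show ?thesis using True y by (simp add: displaced_def)
    next
      case False
      then show ?thesis using chain_tab_ent_iff[OF G dist jl, of t y] t by (auto simp: displaced_def)
    qed
    have "{y. displaced R R' t y ?a} = {G j t<..min (G (Suc j) t) (?N j t)}" unfolding dis by auto
    then show ?thesis using mono[of j t] GN[of t] by simp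
  qed
  let ?p = "(r - 1) mod k"
  have p: "0 \<le> ?p" "?p < k" using k by simp_all
  \<comment> \<open>Between rows \<open>r - 1\<close> and \<open>?p\<close> all three shapes shift
    by the same multiple of \<open>n - k\<close>, which cancels; this matters for
    \<open>r = 0\<close>.\<close>
  have shift: "min (G (Suc j) ?p) (?N j ?p) - G j ?p = min (G (Suc j) (r - 1)) (?N j (r - 1)) - G j (r - 1)"
    using periodic_mod[OF perG, of "Suc j" "r - 1"] periodic_mod[OF perG, of j "r - 1"]
      periodic_mod[OF perN, of "r - 1"] by linarith
  have "\<forall>r v. 0 \<le> r \<longrightarrow> r < k \<longrightarrow>
        card {y. ent R' (r, y) = Some v} + card {y. displaced R R' r y v} + count_list [] (v, r) =
        card {y. ent R (r, y) = Some v} + card {y. displaced R R' ((r - 1) mod k) y v}"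
    using inv unfolding bump_inv_def by blast
  then have "card {y. ent R' (r, y) = Some ?a} + card {y. displaced R R' r y ?a} =
        card {y. ent R (r, y) = Some ?a} + card {y. displaced R R' ?p y ?a}"
    using Suc.prems by simp
  moreover have "level k R' xs (Suc j) r = level k R' xs j r + int (card {y. ent R' (r, y) = Some ?a})"
    using level_Suc[OF R' dist jl, of r] Suc.prems by simp
  moreover have "level k R' xs j r = ?N j r" using Suc.IH Suc.prems by simp
  ultimately show ?case
    using orig[OF Suc.prems(2,3)] disp[OF Suc.prems(2,3)] disp[OF p] shift by simp
qed

lemma FullMulti_chain_tab:
  assumes k: "1 \<le> k" and G: "chain_tab n k xs G R" and xs: "sorted_wrt (<) xs"
    and B: "periodic n k B" "\<And>m. G 0 m \<le> B m"
    and S: "\<And>r y. (r, y) \<in> S \<longleftrightarrow> 0 \<le> r \<and> r < k \<and> G 0 r < y \<and> y \<le> B r"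
  obtains R' where "FullMulti n k R S = Some R'" "chain_tab n k xs (bump_chain G B) R'"
proof -
  have R: "row_tab k R" by (rule chain_tab_row_tab[OF G xs])
  have perG: "periodic n k (G j)" for j using G by (simp add: chain_tab_def)
  have mono: "G j m \<le> G (Suc j) m" for j m using G by (simp add: chain_tab_def)
  have inn: "inner R = G 0" "outer R = G (length xs)" using G by (simp_all add: chain_tab_def)
  have io: "inner R m \<le> outer R m" for m
    unfolding inn by (rule lift_Suc_mono_le[of "\<lambda>j. G j m"]) (use mono in auto)
  have "bump_inv n k R B (fm_init n k R S) (fm_queue0 k R S)"
    by (rule bump_inv_init[OF k R _ _ io B(1)]) (use perG inn B S in auto)
  then obtain R' where R': "FullMulti n k R S = Some R'" and inv: "bump_inv n k R B R' []"
    using FullMulti_terminates[OF k R] by blast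
  have R'_tab: "row_tab k R'" and inn': "inner R' = B" and per': "periodic n k (outer R')"
    and Ble: "\<And>m. B m \<le> outer R' m"
    and W: "\<And>r y v. displaced R' R r y v \<Longrightarrow> \<exists>y'. displaced R R' ((r - 1) mod k) y' v"
    using inv unfolding bump_inv_def by blast+
  have ranR: "v \<in> set xs" if "ent R (r, y) = Some v" for r y v
    using that G unfolding chain_tab_def by (metis nth_mem)
  \<comment> \<open>An entry of \<open>R'\<close> is either original or inserted, and an inserted
    one has a displaced source in \<open>R\<close>.\<close>
  have ran: "ran (ent R') \<subseteq> set xs"
  proof
    fix v assume "v \<in> ran (ent R')"
    then obtain b where "ent R' b = Some v" by (auto simp: ran_def)
    then have "ent R' (fst b, snd b) = Some v" by simp
    then have "\<exists>r y. ent R (r, y) = Some v"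
      using W[of "fst b" "snd b" v] unfolding displaced_def by blast
    then show "v \<in> set xs" using ranR by blast
  qed
  have L: "chain_tab n k xs (level k R' xs) R'"
    by (rule row_tab_chain_tab[OF R'_tab k _ per' _ xs ran]) (use B Ble inn' in auto)
  have perN: "periodic n k (bump_chain G B j)" for j by (rule bump_chain_periodic[OF perG B(1)])
  have monoN: "bump_chain G B j m \<le> bump_chain G B (Suc j) m" for j m
    by (rule bump_chain_mono[of G B, OF mono B(2)])
  have "chain_tab n k xs (bump_chain G B) R'"
  proof (rule chain_tab_cong[where H = "bump_chain G B", OF L _ perN monoN])
    fix j assume "j \<le> length xs"
    then show "level k R' xs j = bump_chain G B j"
      using L bump_inv_final_level[OF k G xs B inv ran] perN unfolding chain_tab_def
      by (intro periodic_ext[OF k]) blast+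
  qed
  then show ?thesis using that R' by blast
qed

section \<open>The growth diagram and its transposition\<close>

text \<open>A growth diagram with boundary chains \<open>V\<close> (index \<open>i = 0\<close>) and
  \<open>H\<close> (index \<open>j = 0\<close>, when \<open>V 0 = H 0\<close>). Fixing
  \<open>i\<close> gives the chain of \<open>P\<close> after \<open>i\<close> letters of
  \<open>U\<close>; fixing \<open>j\<close> at its last value gives the chain of
  \<open>Q\<close>.\<close>

fun grid :: "(nat \<Rightarrow> int \<Rightarrow> int) \<Rightarrow> (nat \<Rightarrow> int \<Rightarrow> int) \<Rightarrow> nat \<Rightarrow> nat \<Rightarrow> int \<Rightarrow> int" where
  "grid H V 0 = V"
| "grid H V (Suc i) = bump_chain (grid H V i) (H (Suc i))"

lemma grid_left: "V 0 = H 0 \<Longrightarrow> grid H V i 0 = H i"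
  by (cases i) (auto simp: fun_eq_iff)

lemma grid_commute:
  assumes "V 0 = H 0"
  shows "grid H V i j = grid V H j i"
proof (induction i arbitrary: j)
  case 0
  show ?case using grid_left[of H V j] assms by simp
next
  case (Suc i)
  show ?case
  proof (induction j)
    case 0
    show ?case using grid_left[of V H "Suc i", OF assms] by simp
  next
    case (Suc j)
    show ?case
    proof
      fix m
      have "grid H V (Suc i) (Suc j) m =
          max (grid H V i (Suc j) m) (grid H V (Suc i) j m)
          + min (grid H V i (Suc j) (m - 1)) (grid H V (Suc i) j (m - 1)) - grid H V i j (m - 1)"
        by simp
      also have "\<dots> = max (grid V H j (Suc i) m) (grid V H (Suc j) i m)
          + min (grid V H j (Suc i) (m - 1)) (grid V H (Suc j) i (m - 1)) - grid V H j i (m - 1)"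
        \<comment> \<open>The outer hypothesis handles index \<open>i\<close>, the inner one the
          index pair \<open>Suc i\<close>, \<open>j\<close>. The exchanged shapes enter the local
          rule only through \<open>max\<close> and \<open>min\<close>.\<close>
        unfolding Suc.IH \<open>\<And>j. grid H V i j = grid V H j i\<close> by (simp only: max.commute min.commute)
      also have "\<dots> = grid V H (Suc j) (Suc i) m" by simp
      finally show "grid H V (Suc i) (Suc j) m = grid V H (Suc j) (Suc i) m" .
    qed
  qed
qed

lemma grid_mono:
  assumes "\<And>j m. V j m \<le> V (Suc j) m" "\<And>i m. H i m \<le> H (Suc i) m" "V 0 = H 0"
  shows "grid H V i j m \<le> grid H V i (Suc j) m"
proof (induction i arbitrary: j m)
  case (Suc i)
  have "grid H V i 0 m \<le> H (Suc i) m" for m using assms(2) grid_left[of V H, OF assms(3)] by simp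
  then show ?case using bump_chain_mono[of "grid H V i" "H (Suc i)"] Suc by simp
qed (use assms in simp)

lemma grid_periodic:
  assumes "\<And>j. periodic n k (V j)" "\<And>i. periodic n k (H i)"
  shows "periodic n k (grid H V i j)"
proof (induction i arbitrary: j)
  case (Suc i)
  then show ?case using bump_chain_periodic[of n k "grid H V i" "H (Suc i)"] assms by simp
qed (use assms in simp)

section \<open>CRSK computes the growth diagram\<close>

text \<open>Inserting one letter moves \<open>P\<close> to the next line of the diagram.
  \<open>Q\<close> receives the letter on the boxes between the old and the new outer shape of
  \<open>P\<close>, which are consecutive shapes of \<open>K\<close>.\<close>

lemma crsk_letter_chain_tab:
  assumes k: "1 \<le> k" and U: "chain_tab n k ys H U" and xs: "sorted_wrt (<) xs" and ys: "distinct ys"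
    and P: "chain_tab n k xs G P" and GH: "G 0 = H i" and i: "i < length ys"
    and Q: "chain_tab n k (take i ys) K Q"
    and K: "K i = G (length xs)" "K (Suc i) = bump_chain G (H (Suc i)) (length xs)"
  obtains P' Q' where "crsk_letter n k U (ys ! i) (Some (P, Q)) = Some (P', Q')"
    and "chain_tab n k xs (bump_chain G (H (Suc i))) P'" and "chain_tab n k (take (Suc i) ys) K Q'"
proof -
  let ?S = "{b. ent U b = Some (ys ! i)}"
  have S: "(r, y) \<in> ?S \<longleftrightarrow> 0 \<le> r \<and> r < k \<and> G 0 r < y \<and> y \<le> H (Suc i) r" for r y
    using chain_tab_ent_iff[OF U ys i] GH by simp
  have perH: "periodic n k (H (Suc i))" and le: "\<And>m. G 0 m \<le> H (Suc i) m"
    using U GH by (simp_all add: chain_tab_def)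
  obtain P' where P': "FullMulti n k P ?S = Some P'" and P'_chain: "chain_tab n k xs (bump_chain G (H (Suc i))) P'"
    using FullMulti_chain_tab[OF k P xs perH le S] by blast
  let ?S' = "new_boxes k P P'"
  let ?Q' = "Q\<lparr> outer := add_boxes n k (outer Q) ?S', ent := (\<lambda>b. if b \<in> ?S' then Some (ys ! i) else ent Q b) \<rparr>"
  have perK: "\<And>j. periodic n k (K j)" and monoK: "\<And>j m. K j m \<le> K (Suc j) m" using Q by (simp_all add: chain_tab_def)
  have outP: "outer P = K i" "outer P' = K (Suc i)" using P P'_chain K by (simp_all add: chain_tab_def)
  have S': "(r, y) \<in> ?S' \<longleftrightarrow> 0 \<le> r \<and> r < k \<and> K i r < y \<and> y \<le> K (Suc i) r" for r y
    by (auto simp: new_boxes_def is_box_def outP)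
  have len: "length (take i ys) = i" "length (take (Suc i) ys) = Suc i" using i by simp_all
  have "outer Q = K i" using Q len by (simp add: chain_tab_def)
  then have outQ': "add_boxes n k (outer Q) ?S' = K (Suc i)"
    by (simp only:) (rule add_boxes_eq[OF k perK perK monoK], simp add: S')
  have entQ': "ent ?Q' (r, y) = Some v \<longleftrightarrow>
      0 \<le> r \<and> r < k \<and> (\<exists>j < length (take (Suc i) ys). v = take (Suc i) ys ! j \<and> K j r < y \<and> y \<le> K (Suc j) r)" for r y v
  proof -
    have old: "ent Q (r, y) = Some v \<longleftrightarrow> 0 \<le> r \<and> r < k \<and> (\<exists>j < i. v = ys ! j \<and> K j r < y \<and> y \<le> K (Suc j) r)"
    proof -
      have "ent Q (r, y) = Some v \<longleftrightarrow> 0 \<le> r \<and> r < k \<and>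
          (\<exists>j < i. v = take i ys ! j \<and> K j r < y \<and> y \<le> K (Suc j) r)"
        using Q unfolding chain_tab_def len by blast
      then show ?thesis by (metis nth_take)
    qed
    have new: "(\<exists>j < Suc i. v = take (Suc i) ys ! j \<and> K j r < y \<and> y \<le> K (Suc j) r) \<longleftrightarrow>
        (\<exists>j < Suc i. v = ys ! j \<and> K j r < y \<and> y \<le> K (Suc j) r)"
      by (metis nth_take)
    \<comment> \<open>Earlier letters of \<open>Q\<close> lie within \<open>K i\<close>, so the new
      letter overwrites none of them.\<close>
    have "\<not> (\<exists>j < i. K j r < y \<and> y \<le> K (Suc j) r)" if "K i r < y"
      using chain_cover[of "\<lambda>j. K j r" y i] monoK that by auto
    then show ?thesis unfolding len new using S'[of r y] old by (auto simp: less_Suc_eq)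
  qed
  have "inner ?Q' = K 0" using Q by (simp add: chain_tab_def)
  moreover have "outer ?Q' = K (length (take (Suc i) ys))" unfolding len using outQ' by simp
  ultimately have "chain_tab n k (take (Suc i) ys) K ?Q'"
    unfolding chain_tab_def by (intro conjI allI perK monoK entQ')
  moreover have "crsk_letter n k U (ys ! i) (Some (P, Q)) = Some (P', ?Q')"
    using P' by (simp add: crsk_letter_def Let_def)
  ultimately show ?thesis using that P'_chain by blast
qed

text \<open>Loop invariant: after \<open>i\<close> letters, line \<open>i\<close> of the diagram
  encodes \<open>P\<close>, and the first \<open>i\<close> steps along its last column encode
  \<open>Q\<close>.\<close>

lemma CRSK_chain_tab:
  assumes k: "1 \<le> k" and T: "chain_tab n k xs V T" and U: "chain_tab n k ys H U"
    and xs: "sorted_wrt (<) xs" and ys: "sorted_list_of_set (ran (ent U)) = ys" and VH: "V 0 = H 0"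
  obtains P Q where "CRSK n k ((T, U), mu) = Some ((P, Q), outer P)"
    and "chain_tab n k xs (grid H V (length ys)) P"
    and "chain_tab n k ys (\<lambda>i. grid H V i (length xs)) Q"
proof -
  let ?Q0 = "\<lparr> outer = outer T, inner = outer T, ent = (\<lambda>_. None) \<rparr>"
  let ?K = "\<lambda>i. grid H V i (length xs)"
  have perV: "\<And>j. periodic n k (V j)" and perH: "\<And>j. periodic n k (H j)"
    and monoV: "\<And>j m. V j m \<le> V (Suc j) m" and monoH: "\<And>j m. H j m \<le> H (Suc j) m"
    using T U by (simp_all add: chain_tab_def)
  have "\<exists>P Q. fold (crsk_letter n k U) (take i ys) (Some (T, ?Q0)) = Some (P, Q) \<and>
      chain_tab n k xs (grid H V i) P \<and> chain_tab n k (take i ys) ?K Q" if "i \<le> length ys" for i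
    using that
  proof (induction i)
    case 0
    \<comment> \<open>Monotonicity in the first index is \<open>grid_mono\<close> for the transposed
      diagram.\<close>
    have "?K i m \<le> ?K (Suc i) m" for i m
      unfolding grid_commute[of V H, OF VH] by (rule grid_mono[OF monoH monoV VH[symmetric]])
    then have "chain_tab n k [] ?K ?Q0"
      using T grid_periodic[OF perV perH] by (simp add: chain_tab_def)
    then show ?case using T by simp
  next
    case (Suc i)
    then obtain P Q where PQ: "fold (crsk_letter n k U) (take i ys) (Some (T, ?Q0)) = Some (P, Q)"
      "chain_tab n k xs (grid H V i) P" "chain_tab n k (take i ys) ?K Q" by auto
    have i: "i < length ys" using Suc.prems by simp
    have dist: "distinct ys" using ys by auto
    obtain P' Q' where "crsk_letter n k U (ys ! i) (Some (P, Q)) = Some (P', Q')"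
      "chain_tab n k xs (grid H V (Suc i)) P'" "chain_tab n k (take (Suc i) ys) ?K Q'"
      using crsk_letter_chain_tab[OF k U xs dist PQ(2) grid_left[of V H, OF VH] i PQ(3)] by auto
    then show ?case using PQ(1) i by (simp add: take_Suc_conv_app_nth)
  qed
  from this[of "length ys"] obtain P Q where "fold (crsk_letter n k U) ys (Some (T, ?Q0)) = Some (P, Q)"
    and *: "chain_tab n k xs (grid H V (length ys)) P" "chain_tab n k ys ?K Q" by auto
  then have "CRSK n k ((T, U), mu) = Some ((P, Q), outer P)" by (simp add: CRSK_def Let_def ys)
  then show ?thesis using that * by blast
qed

lemma SSCT_chain_tab:
  assumes k: "1 \<le> k" and T: "T \<in> SSCT n k alpha mu" and xs: "sorted_list_of_set (ran (ent T)) = xs"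
  shows "sorted_wrt (<) xs" "chain_tab n k xs (level k T xs) T" "level k T xs 0 = mu"
proof -
  have proj: "proj n k (r, y) = (r, y)" if "0 \<le> r" "r < k" for r y
    using that by (simp add: proj_def)
  have sh: "outer T = alpha" "inner T = mu" and cyl: "cyl_partition n k alpha" "cyl_partition n k mu"
    and le: "contained mu alpha" and dom: "\<And>b. ent T b \<noteq> None \<longleftrightarrow> b \<in> skew_boxes k alpha mu"
    and row: "\<And>x y1 y2. in_skew alpha mu (x, y1) \<Longrightarrow> in_skew alpha mu (x, y2) \<Longrightarrow> y1 < y2 \<Longrightarrow>
        the (ent T (proj n k (x, y1))) \<le> the (ent T (proj n k (x, y2)))"
    using T unfolding SSCT_def by blast+
  have tab: "row_tab k T"
    unfolding row_tab_def
  proof (intro conjI allI impI)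
    show dom': "ent T (r, y) \<noteq> None \<longleftrightarrow> 0 \<le> r \<and> r < k \<and> inner T r < y \<and> y \<le> outer T r" for r y
      unfolding dom sh by (auto simp: skew_boxes_def is_box_def in_skew_def)
    fix r y y' v v' assume *: "ent T (r, y) = Some v" "ent T (r, y') = Some v'" "y \<le> y'"
    then show "v \<le> v'"
      using dom'[of r y] dom'[of r y'] row[of r y y'] proj[of r] sh
      by (cases "y = y'") (auto simp: in_skew_def)
  qed
  show sorted: "sorted_wrt (<) xs" using strict_sorted_list_of_set xs by blast
  show "chain_tab n k xs (level k T xs) T"
  proof (rule row_tab_chain_tab[OF tab k _ _ _ sorted])
    show "periodic n k (inner T)" "periodic n k (outer T)"
      using cyl unfolding sh cyl_partition_def periodic_def by blast+
    show "inner T m \<le> outer T m" for m using le by (simp add: contained_def sh)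
    show "ran (ent T) \<subseteq> set xs" using row_tab_finite_ran[OF tab] xs by auto
  qed
  show "level k T xs 0 = mu" using sh by (simp add: level_def fun_eq_iff)
qed

theorem mainTheorem4:
  fixes n k :: int
    and mu alpha beta lam :: "int \<Rightarrow> int"
    and T U P Q :: "('a::linorder) tab"
  assumes "1 \<le> k" and "k < n"
    and "cyl_partition n k mu" and "cyl_partition n k alpha" and "cyl_partition n k beta"
    and "contained mu alpha" and "contained mu beta"
    and "T \<in> SSCT n k alpha mu" and "U \<in> SSCT n k beta mu"
    and "CRSK n k ((T, U), mu) = Some ((P, Q), lam)"
  shows "CRSK n k ((U, T), mu) = Some ((Q, P), lam)"
proof -
  define xs where "xs = sorted_list_of_set (ran (ent T))"
  define ys where "ys = sorted_list_of_set (ran (ent U))"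
  let ?V = "level k T xs" and ?H = "level k U ys"
  note Tc = SSCT_chain_tab[OF assms(1,8) xs_def[symmetric]]
  note Uc = SSCT_chain_tab[OF assms(1,9) ys_def[symmetric]]
  have VH: "?V 0 = ?H 0" using Tc(3) Uc(3) by simp
  obtain P1 Q1 where 1: "CRSK n k ((T, U), mu) = Some ((P1, Q1), outer P1)"
    "chain_tab n k xs (grid ?H ?V (length ys)) P1" "chain_tab n k ys (\<lambda>i. grid ?H ?V i (length xs)) Q1"
    using CRSK_chain_tab[OF assms(1) Tc(2) Uc(2) Tc(1) ys_def[symmetric] VH] by blast
  obtain P2 Q2 where 2: "CRSK n k ((U, T), mu) = Some ((P2, Q2), outer P2)"
    "chain_tab n k ys (grid ?V ?H (length xs)) P2" "chain_tab n k xs (\<lambda>i. grid ?V ?H i (length ys)) Q2"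
    using CRSK_chain_tab[OF assms(1) Uc(2) Tc(2) Uc(1) xs_def[symmetric] VH[symmetric]] by blast
  \<comment> \<open>The last column of each diagram is the last line of its transpose, so
    \<open>P\<close> and \<open>Q\<close> trade roles.\<close>
  have "(\<lambda>i. grid ?V ?H i (length ys)) = grid ?H ?V (length ys)"
    "(\<lambda>i. grid ?H ?V i (length xs)) = grid ?V ?H (length xs)"
    using grid_commute[of ?V ?H, OF VH] by auto
  then have "Q2 = P1" "P2 = Q1" using 1 2 chain_tab_unique by metis+
  \<comment> \<open>Both shapes are the corner of the diagram at the indices
    \<open>length ys\<close> and \<open>length xs\<close>.\<close>
  moreover have "outer P1 = outer Q1"
    using 1 by (simp add: chain_tab_def)
  ultimately show ?thesis using 1(1) 2(1) assms(10) by simp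
qed

end
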